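(* There is an algorithm that, given valuation functions $v_i(\cdot)$ for $i\in[N]$, learns the revenue-maximizing two-part tariff for $K$ units of the good from the $N$ samples in $O(RNK)$ time, where $R$ is the number of pieces in the total dual class function $U_{\langle v_1,\dots,v_N\rangle}(\cdot)$.
   Context: A seller has $K$ identical units of an item. Sample $i\in[N]$ is given by a valuation $v_i:\{1,\dots,K\}\to\mathbb{R}_{\ge0}$ (with value $0$ for buying nothing). A two-part tariff is a price vector $\rho=(p_1,p_2)$ with $p_1,p_2\ge0$: buying $q\ge1$ units costs $p_1+p_2q$. In sample $i$ the buyer purchases a quantity $q\in\{1,\dots,K\}$ maximizing the utility $v_i(q)-(p_1+p_2q)$, and purchases zero units if this utility is negative for every $q>0$. The revenue from sample $i$ is $0$ if zero units are bought and $p_1+p_2q$ if $q>0$ units are bought. The total dual class function is $U_{\langle v_1,\dots,v_N\rangle}(\rho)=$ the sum over $i\in[N]$ of the revenue from sample $i$ at tariff $\rho$. Its pieces are the distinct regions of the $(p_1,p_2)$ space on which the buyer's choice of the number of items purchased in each sample is fixed; $R$ denotes their number. The revenue-maximizing tariff is a $\rho$ maximizing $U_{\langle v_1,\dots,v_N\rangle}(\rho)$. *)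

theory Defs
  imports Complex_Main
begin

section \<open>Two-part tariffs\<close>

text \<open>A tariff is a pair \<open>\<rho> = (p\<^sub>1, p\<^sub>2)\<close>. A valuation is only ever evaluated at
  quantities in \<open>{1..K}\<close>; buying nothing has value and utility 0.\<close>

definition tariffs :: "(real \<times> real) set" where
  "tariffs = {\<rho>. 0 \<le> fst \<rho> \<and> 0 \<le> snd \<rho>}"

definition price :: "real \<times> real \<Rightarrow> nat \<Rightarrow> real" where
  "price \<rho> q = fst \<rho> + snd \<rho> * real q"

definition utility :: "(nat \<Rightarrow> real) \<Rightarrow> real \<times> real \<Rightarrow> nat \<Rightarrow> real" where
  "utility v \<rho> q = v q - price \<rho> q"

definition best_quantities :: "nat \<Rightarrow> (nat \<Rightarrow> real) \<Rightarrow> real \<times> real \<Rightarrow> nat set" where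
  "best_quantities K v \<rho> = {q \<in> {1..K}. \<forall>r \<in> {1..K}. utility v \<rho> r \<le> utility v \<rho> q}"

text \<open>A buyer who is indifferent between several utility-maximizing quantities takes the largest
  one, i.e. ties are resolved in favour of the seller. Without such a rule the supremum of the
  total revenue need not be attained.\<close>

definition purchase :: "nat \<Rightarrow> (nat \<Rightarrow> real) \<Rightarrow> real \<times> real \<Rightarrow> nat" where
  "purchase K v \<rho> =
     (if \<forall>q \<in> {1..K}. utility v \<rho> q < 0 then 0 else Max (best_quantities K v \<rho>))"

definition revenue :: "nat \<Rightarrow> (nat \<Rightarrow> real) \<Rightarrow> real \<times> real \<Rightarrow> real" where
  "revenue K v \<rho> = (if purchase K v \<rho> = 0 then 0 else price \<rho> (purchase K v \<rho>))"

text \<open>The \<open>N\<close> samples are \<open>v 0, \<dots>, v (N - 1)\<close>.\<close>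

definition total_revenue :: "nat \<Rightarrow> nat \<Rightarrow> (nat \<Rightarrow> nat \<Rightarrow> real) \<Rightarrow> real \<times> real \<Rightarrow> real" where
  "total_revenue N K v \<rho> = (\<Sum>i<N. revenue K (v i) \<rho>)"

definition same_purchases ::
    "nat \<Rightarrow> nat \<Rightarrow> (nat \<Rightarrow> nat \<Rightarrow> real) \<Rightarrow> ((real \<times> real) \<times> (real \<times> real)) set" where
  "same_purchases N K v =
     {(\<rho>, \<sigma>) \<in> tariffs \<times> tariffs. \<forall>i<N. purchase K (v i) \<rho> = purchase K (v i) \<sigma>}"

text \<open>Each equivalence class is the set of tariffs inducing one particular vector of purchased
  quantities. Being an intersection of (open or closed) half-planes it is convex, so it is a single
  connected region.\<close>

definition pieces :: "nat \<Rightarrow> nat \<Rightarrow> (nat \<Rightarrow> nat \<Rightarrow> real) \<Rightarrow> (real \<times> real) set set" where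
  "pieces N K v = tariffs // same_purchases N K v"

lemma purchase_le: "purchase K v \<rho> \<le> K"
proof (cases "\<forall>q \<in> {1..K}. utility v \<rho> q < 0")
  case False
  then have "{1..K} \<noteq> {}" by auto
  define m where "m = Max (utility v \<rho> ` {1..K})"
  have "m \<in> utility v \<rho> ` {1..K}"
    unfolding m_def using \<open>{1..K} \<noteq> {}\<close> by (intro Max_in) auto
  then obtain q where "q \<in> {1..K}" "utility v \<rho> q = m" by auto
  then have "q \<in> best_quantities K v \<rho>"
    by (auto simp: best_quantities_def m_def)
  moreover have "finite (best_quantities K v \<rho>)" by (simp add: best_quantities_def)
  ultimately have "Max (best_quantities K v \<rho>) \<in> best_quantities K v \<rho>"
    by (intro Max_in) auto
  then show ?thesis by (auto simp: purchase_def best_quantities_def)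
qed (simp add: purchase_def)

lemma finite_pieces: "finite (pieces N K v)"
proof -
  let ?prof = "\<lambda>\<rho>. map (\<lambda>i. purchase K (v i) \<rho>) [0..<N]"
  let ?cls = "\<lambda>xs. {\<sigma> \<in> tariffs. ?prof \<sigma> = xs}"
  have "pieces N K v \<subseteq> ?cls ` {xs. set xs \<subseteq> {..K} \<and> length xs = N}"
  proof
    fix P assume "P \<in> pieces N K v"
    then obtain \<rho> where \<rho>: "\<rho> \<in> tariffs" "P = same_purchases N K v `` {\<rho>}"
      by (auto simp: pieces_def elim: quotientE)
    then have "P = ?cls (?prof \<rho>)" by (auto simp: same_purchases_def)
    moreover have "?prof \<rho> \<in> {xs. set xs \<subseteq> {..K} \<and> length xs = N}"
      by (auto simp: purchase_le)
    ultimately show "P \<in> ?cls ` {xs. set xs \<subseteq> {..K} \<and> length xs = N}" by blast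
  qed
  then show ?thesis
    by (rule finite_subset) (simp add: finite_lists_length_eq)
qed


section \<open>Algorithms: a real RAM\<close>

text \<open>Programs of a real random access machine, in structured form. The memory consists of
  unbounded arrays of natural numbers and of reals; a program mentions only finitely many of them,
  and a scalar variable is an array cell with constant index. Reals support exact field arithmetic
  and comparison. Naturals serve as indices and counters; they support addition, truncated
  subtraction and comparison. There is no rounding of reals to integers, no integer multiplication
  or bit operation, and the only real constants are casts of naturals.

  Every operator, memory access, test, and command executed costs one time unit.\<close>

type_synonym arr = string

datatype nexp =
    NConst nat
  | NRead arr nexp
  | NAdd nexp nexp
  | NSub nexp nexp

datatype rexp =
    RCast nexp
  | RRead arr nexp
  | RAdd rexp rexp
  | RSub rexp rexp
  | RMul rexp rexp
  | RDiv rexp rexp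

datatype bexp =
    NLess nexp nexp
  | RLess rexp rexp
  | BNot bexp
  | BAnd bexp bexp

datatype com =
    Skip
  | NWrite arr nexp nexp
  | RWrite arr nexp rexp
  | Seq com com
  | If bexp com com
  | While bexp com

record state =
  nats :: "arr \<Rightarrow> nat \<Rightarrow> nat"
  reals :: "arr \<Rightarrow> nat \<Rightarrow> real"

primrec nval :: "nexp \<Rightarrow> state \<Rightarrow> nat" where
  "nval (NConst n) s = n"
| "nval (NRead a e) s = nats s a (nval e s)"
| "nval (NAdd e f) s = nval e s + nval f s"
| "nval (NSub e f) s = nval e s - nval f s"

primrec rval :: "rexp \<Rightarrow> state \<Rightarrow> real" where
  "rval (RCast e) s = real (nval e s)"
| "rval (RRead a e) s = reals s a (nval e s)"
| "rval (RAdd e f) s = rval e s + rval f s"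
| "rval (RSub e f) s = rval e s - rval f s"
| "rval (RMul e f) s = rval e s * rval f s"
| "rval (RDiv e f) s = rval e s / rval f s"

primrec bval :: "bexp \<Rightarrow> state \<Rightarrow> bool" where
  "bval (NLess e f) s \<longleftrightarrow> nval e s < nval f s"
| "bval (RLess e f) s \<longleftrightarrow> rval e s < rval f s"
| "bval (BNot b) s \<longleftrightarrow> \<not> bval b s"
| "bval (BAnd b c) s \<longleftrightarrow> bval b s \<and> bval c s"

primrec ncost :: "nexp \<Rightarrow> nat" where
  "ncost (NConst n) = 1"
| "ncost (NRead a e) = ncost e + 1"
| "ncost (NAdd e f) = ncost e + ncost f + 1"
| "ncost (NSub e f) = ncost e + ncost f + 1"

primrec rcost :: "rexp \<Rightarrow> nat" where
  "rcost (RCast e) = ncost e + 1"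
| "rcost (RRead a e) = ncost e + 1"
| "rcost (RAdd e f) = rcost e + rcost f + 1"
| "rcost (RSub e f) = rcost e + rcost f + 1"
| "rcost (RMul e f) = rcost e + rcost f + 1"
| "rcost (RDiv e f) = rcost e + rcost f + 1"

primrec bcost :: "bexp \<Rightarrow> nat" where
  "bcost (NLess e f) = ncost e + ncost f + 1"
| "bcost (RLess e f) = rcost e + rcost f + 1"
| "bcost (BNot b) = bcost b + 1"
| "bcost (BAnd b c) = bcost b + bcost c + 1"

definition write_nat :: "arr \<Rightarrow> nat \<Rightarrow> nat \<Rightarrow> state \<Rightarrow> state" where
  "write_nat a i x s = s\<lparr>nats := (nats s)(a := (nats s a)(i := x))\<rparr>"

definition write_real :: "arr \<Rightarrow> nat \<Rightarrow> real \<Rightarrow> state \<Rightarrow> state" where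
  "write_real a i x s = s\<lparr>reals := (reals s)(a := (reals s a)(i := x))\<rparr>"

text \<open>\<open>exec c s t s'\<close>: started in \<open>s\<close>, program \<open>c\<close> halts in \<open>s'\<close> after \<open>t\<close> time units.\<close>

inductive exec :: "com \<Rightarrow> state \<Rightarrow> nat \<Rightarrow> state \<Rightarrow> bool" where
  Skip: "exec Skip s 1 s"
| NWrite: "exec (NWrite a e f) s (ncost e + ncost f + 1) (write_nat a (nval e s) (nval f s) s)"
| RWrite: "exec (RWrite a e f) s (ncost e + rcost f + 1) (write_real a (nval e s) (rval f s) s)"
| Seq: "exec c s t s' \<Longrightarrow> exec d s' t' s'' \<Longrightarrow> exec (Seq c d) s (t + t') s''"
| IfTrue: "bval b s \<Longrightarrow> exec c s t s' \<Longrightarrow> exec (If b c d) s (bcost b + 1 + t) s'"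
| IfFalse: "\<not> bval b s \<Longrightarrow> exec d s t s' \<Longrightarrow> exec (If b c d) s (bcost b + 1 + t) s'"
| WhileFalse: "\<not> bval b s \<Longrightarrow> exec (While b c) s (bcost b + 1) s"
| WhileTrue: "bval b s \<Longrightarrow> exec c s t s' \<Longrightarrow> exec (While b c) s' t' s'' \<Longrightarrow>
    exec (While b c) s (bcost b + 1 + t + t') s''"

inductive_cases Skip_E: "exec Skip s t s'"
inductive_cases NWrite_E: "exec (NWrite a e f) s t s'"
inductive_cases RWrite_E: "exec (RWrite a e f) s t s'"
inductive_cases Seq_E: "exec (Seq c d) s t s'"
inductive_cases If_E: "exec (If b c d) s t s'"
inductive_cases While_E: "exec (While b c) s t s'"

lemma exec_deterministic:
  "exec c s t s' \<Longrightarrow> exec c s u r \<Longrightarrow> t = u \<and> s' = r"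
proof (induction arbitrary: u r rule: exec.induct)
  case Skip then show ?case by (auto elim: Skip_E)
next
  case NWrite then show ?case by (auto elim: NWrite_E)
next
  case RWrite then show ?case by (auto elim: RWrite_E)
next
  case (Seq c s t s' d t' s'')
  from Seq.prems obtain t1 s1 t2 where "exec c s t1 s1" "exec d s1 t2 r" "u = t1 + t2"
    by (rule Seq_E)
  with Seq.IH show ?case by metis
next
  case (IfTrue b s c t s' d)
  from IfTrue.prems IfTrue.hyps(1) obtain t1 where "exec c s t1 r" "u = bcost b + 1 + t1"
    by (auto elim: If_E)
  with IfTrue.IH show ?case by metis
next
  case (IfFalse b s d t s' c)
  from IfFalse.prems IfFalse.hyps(1) obtain t1 where "exec d s t1 r" "u = bcost b + 1 + t1"
    by (auto elim: If_E)
  with IfFalse.IH show ?case by metis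
next
  case WhileFalse
  from WhileFalse.prems WhileFalse.hyps show ?case by (auto elim: While_E)
next
  case (WhileTrue b s c t s' t' s'')
  from WhileTrue.prems WhileTrue.hyps(1) obtain t1 s1 t2 where
    "exec c s t1 s1" "exec (While b c) s1 t2 r" "u = bcost b + 1 + t1 + t2"
    by (auto elim: While_E)
  with WhileTrue.IH show ?case by metis
qed

text \<open>The valuations are stored row by row: cell \<open>i * K + (q - 1)\<close> of the array \<open>''v''\<close> holds
  \<open>v i q\<close>. All memory not used for the input is zero.\<close>

definition input_state :: "nat \<Rightarrow> nat \<Rightarrow> (nat \<Rightarrow> nat \<Rightarrow> real) \<Rightarrow> state" where
  "input_state N K v =
     \<lparr>nats = (\<lambda>a j. if a = ''N'' \<and> j = 0 then N else if a = ''K'' \<and> j = 0 then K else 0),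
      reals = (\<lambda>a j. if a = ''v'' \<and> j < N * K then v (j div K) (j mod K + 1) else 0)\<rparr>"

definition output_tariff :: "state \<Rightarrow> real \<times> real" where
  "output_tariff s = (reals s ''p'' 0, reals s ''p'' 1)"

end

theory Submission
  imports Defs
begin

text \<open>Write \<open>f\<^sub>i p\<^sub>2\<close> for the maximum of \<open>v\<^sub>i(q) - q p\<^sub>2\<close> over \<open>0 \<le> q \<le> K\<close>. Sample \<open>i\<close> buys at
  \<open>(p\<^sub>1, p\<^sub>2)\<close> iff \<open>p\<^sub>1 \<le> f\<^sub>i p\<^sub>2\<close>, and the quantity then depends on \<open>p\<^sub>2\<close> only. Hence an optimal
  tariff lies on one of the convex piecewise linear curves \<open>p\<^sub>1 = f\<^sub>i p\<^sub>2\<close>,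
      and at a \<open>p\<^sub>2\<close> that is 0, a
  breakpoint of a curve, or a crossing of two curves.

  Sweep \<open>p\<^sub>2\<close> downwards from a value beyond which nobody buys, where all curves coincide, so that no
  initial sorting is needed. With the curves kept in order of height, the next event is the largest
  among the next breakpoints and the crossings of neighbours;
      prefix sums evaluate the revenue on all
  curves at an event in time \<open>O(N)\<close>; and the order is restored
      by a bucket sort according to the slopes,
  which are integers up to \<open>K\<close>, inside the blocks of equal height. So an event costs \<open>O(N K)\<close>. Every
  positive event is the right end of a piece, hence there are at most \<open>R\<close> of them.\<close>

section \<open>Demand and surplus\<close>

text \<open>The delicate point is what remains true at an event itself, where the revenue jumps. The
  conditions on breakpoints and crossings therefore come in a strict and a weak form. Strictly
  between two events the old quantities are the demand. At the left event they still maximize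
  utility but need not be the largest maximizers; since ties favour the seller, the revenue there is
  at least what the old formula predicts. So the formula is affine, an upper bound inside the
  interval and a lower bound at both ends, which is all that comparing an interval with its ends
  requires. The old order is also still sorted by the new heights, so blocks of equal height are
  contiguous and can be rearranged in place. Many curves may meet in one point and be permuted
  arbitrarily there; a comparison sort would cost a factor log N that R N K does not allow. The last
  event, 0, need not be charged to a piece: it adds one step, which is absorbed because R is at
  least 1.\<close>

text \<open>Buying nothing is treated as quantity 0 of value 0, so that every curve is nonnegative and
  ends in the zero line; crossings at negative heights, which would not correspond to any piece,
  never arise.\<close>

definition ext :: "(nat \<Rightarrow> real) \<Rightarrow> nat \<Rightarrow> real" where
  "ext w q = (if q = 0 then 0 else w q)"

definition line :: "(nat \<Rightarrow> real) \<Rightarrow> nat \<Rightarrow> real \<Rightarrow> real" where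
  "line w q p = ext w q - real q * p"

text \<open>A scan through the quantities in the form the inner loop of the program executes, so
  that the loop invariant is this recursion itself. A tie moves on to the larger quantity, as in
  \<open>purchase\<close>.\<close>

primrec demand :: "(nat \<Rightarrow> real) \<Rightarrow> real \<Rightarrow> nat \<Rightarrow> nat" where
  "demand w p 0 = 0"
| "demand w p (Suc m) =
     (if line w (Suc m) p < line w (demand w p m) p then demand w p m else Suc m)"

lemma demand_le: "demand w p m \<le> m"
  by (induction m) auto

lemma line_le_demand: "r \<le> m \<Longrightarrow> line w r p \<le> line w (demand w p m) p"
  by (induction m) (auto simp: le_Suc_eq)

lemma line_less_demand:
  "r \<le> m \<Longrightarrow> demand w p m < r \<Longrightarrow> line w r p < line w (demand w p m) p"
  by (induction m) (auto simp: le_Suc_eq split: if_splits)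

lemma demand_eqI:
  assumes "q \<le> m" "\<And>r. r \<le> m \<Longrightarrow> line w r p \<le> line w q p"
    "\<And>r. r \<le> m \<Longrightarrow> q < r \<Longrightarrow> line w r p < line w q p"
  shows "demand w p m = q"
proof (rule ccontr)
  assume "demand w p m \<noteq> q"
  then consider "demand w p m < q" | "q < demand w p m" by linarith
  then show False
  proof cases
    case 1 then show ?thesis using line_less_demand[OF assms(1) 1] assms(2)[OF demand_le]
        by (meson not_less)
  next
    case 2 then show ?thesis using assms(3)[OF demand_le 2] line_le_demand[OF assms(1)]
        by (meson not_less)
  qed
qed

text \<open>The demand is the largest maximizer. This is needed at an event, where the old quantity
  is still a maximizer but may have been overtaken by a larger one.\<close>

lemma demand_ge:
  assumes "q \<le> m" "\<And>r. r \<le> m \<Longrightarrow> line w r p \<le> line w q p"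
  shows "q \<le> demand w p m"
  using line_less_demand[OF assms(1), of w p] assms(2)[OF demand_le, of w p]
  by (meson not_less)

definition surplus :: "nat \<Rightarrow> (nat \<Rightarrow> real) \<Rightarrow> real \<Rightarrow> real" where
  "surplus K w p = line w (demand w p K) p"

lemma line_le_surplus: "r \<le> K \<Longrightarrow> line w r p \<le> surplus K w p"
  by (simp add: surplus_def line_le_demand)

lemma surplus_nonneg: "0 \<le> surplus K w p"
  using line_le_surplus[of 0 K w p] by (simp add: line_def ext_def)

lemma utility_eq_line: "1 \<le> q \<Longrightarrow> utility w (p\<^sub>1, p) q = line w q p - p\<^sub>1"
  by (simp add: utility_def price_def line_def ext_def)

text \<open>The fee p1 shifts the utilities of all positive quantities alike, so it decides only
  whether to buy. Quantity 0 wins the scan only if every positive quantity is strictly worse, so a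
  buyer willing to pay a nonnegative fee has positive demand.\<close>

lemma purchase_eq_demand:
  assumes "0 \<le> p\<^sub>1"
  shows "purchase K w (p\<^sub>1, p) = (if surplus K w p < p\<^sub>1 then 0 else demand w p K)"
proof (cases "\<forall>q \<in> {1..K}. utility w (p\<^sub>1, p) q < 0")
  case True
  have "demand w p K = 0" if "p\<^sub>1 \<le> surplus K w p"
  proof (rule ccontr)
    assume "demand w p K \<noteq> 0"
    then have "utility w (p\<^sub>1, p) (demand w p K) < 0" using True demand_le[of w p K] by simp
    with \<open>demand w p K \<noteq> 0\<close> show False using that by (simp add: utility_eq_line surplus_def)
  qed
  with True show ?thesis by (auto simp: purchase_def)
next
  case False
  then obtain q where q: "q \<in> {1..K}" "p\<^sub>1 \<le> line w q p" by (auto simp: utility_eq_line)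
  then have le: "p\<^sub>1 \<le> surplus K w p" using line_le_surplus[of q K w p] by simp
  have pos: "demand w p K \<noteq> 0"
  proof
    assume 0: "demand w p K = 0"
    then have "line w q p < 0" using line_less_demand[of q K w p] q by (simp add: line_def ext_def)
    then show False using q assms by simp
  qed
  have "Max (best_quantities K w (p\<^sub>1, p)) = demand w p K"
  proof (rule Max_eqI)
    show "finite (best_quantities K w (p\<^sub>1, p))" by (simp add: best_quantities_def)
    show "demand w p K \<in> best_quantities K w (p\<^sub>1, p)"
      using pos demand_le[of w p K] line_le_demand[of _ K w p]
      by (auto simp: best_quantities_def utility_eq_line)
    fix r assume r: "r \<in> best_quantities K w (p\<^sub>1, p)"
    then have "line w (demand w p K) p \<le> line w r p"
      using pos demand_le[of w p K]
      by (force simp: best_quantities_def utility_eq_line)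
    then show "r \<le> demand w p K"
      using r line_less_demand[of r K w p] by (force simp: best_quantities_def)
  qed
  with False le show ?thesis by (auto simp: purchase_def)
qed

lemma revenue_eq_demand:
  assumes "0 \<le> p\<^sub>1"
  shows "revenue K w (p\<^sub>1, p) =
    (if surplus K w p < p\<^sub>1 \<or> demand w p K = 0 then 0 else p\<^sub>1 + p * real (demand w p K))"
  by (simp add: revenue_def purchase_eq_demand[OF assms] price_def)

text \<open>\<open>S\<close> need not contain all buyers, and \<open>q\<close> need only be a lower
  bound for the demand, so that outdated quantities are admissible at an event.\<close>

lemma total_revenue_ge:
  assumes S: "S \<subseteq> {..<N}" and "0 \<le> H" "0 \<le> p"
    and q: "\<And>i. i \<in> S \<Longrightarrow> q i \<le> demand (v i) p K"
    and H: "\<And>i. i \<in> S \<Longrightarrow> H \<le> surplus K (v i) p"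
  shows "(\<Sum>i\<in>S. H + p * real (q i)) \<le> total_revenue N K v (H, p)"
proof -
  have "(\<Sum>i\<in>S. H + p * real (q i)) \<le> (\<Sum>i\<in>S. revenue K (v i) (H, p))"
  proof (rule sum_mono)
    fix i assume i: "i \<in> S"
    show "H + p * real (q i) \<le> revenue K (v i) (H, p)"
    proof (cases "demand (v i) p K = 0")
      case True
      \<comment> \<open>A sample with demand 0 has surplus 0, which forces the fee \<open>H\<close>
        to be 0; nothing is lost although this sample pays nothing.\<close>
      then have "H \<le> 0" "q i = 0" using H[OF i] q[OF i] by (auto simp: surplus_def line_def ext_def)
      then show ?thesis using \<open>0 \<le> H\<close> True by (simp add: revenue_eq_demand)
    next
      case False
      then show ?thesis using H[OF i] q[OF i] assms(2,3)
        by (auto simp: revenue_eq_demand intro: mult_left_mono)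
    qed
  qed
  also have "\<dots> \<le> total_revenue N K v (H, p)"
    unfolding total_revenue_def using assms by (intro sum_mono2) (auto simp: revenue_eq_demand)
  finally show ?thesis .
qed

section \<open>Revenue along the curves as prefix sums\<close>

definition height_order :: "nat \<Rightarrow> (nat \<Rightarrow> nat \<Rightarrow> real) \<Rightarrow> real \<Rightarrow> (nat \<Rightarrow> nat) \<Rightarrow> (nat \<Rightarrow> nat) \<Rightarrow>
    bool" where
  "height_order N v p q ord \<longleftrightarrow> bij_betw ord {..<N} {..<N} \<and>
     (\<forall>k l. k < l \<longrightarrow> l < N \<longrightarrow> line (v (ord l)) (q (ord l)) p \<le> line (v (ord k)) (q (ord k)) p)"

text \<open>Income at the fee equal to the height of position \<open>k\<close> if exactly the
  positions up to \<open>k\<close> buy their \<open>q\<close>. For fixed \<open>q\<close> and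
  \<open>ord\<close> it is affine in the unit price. It is only a lower bound for the revenue: later
  positions of the same height buy as well.\<close>

definition prefix_revenue :: "(nat \<Rightarrow> nat \<Rightarrow> real) \<Rightarrow> (nat \<Rightarrow> nat) \<Rightarrow> (nat \<Rightarrow> nat) \<Rightarrow> nat \<Rightarrow> real \<Rightarrow>
    real" where
  "prefix_revenue v q ord k p =
     real (Suc k) * line (v (ord k)) (q (ord k)) p + p * real (\<Sum>j\<le>k. q (ord j))"

lemma prefix_revenue_le:
  assumes ord: "height_order N v p q ord" and "k < N" "0 \<le> p"
    and q: "\<And>i. i < N \<Longrightarrow> q i \<le> demand (v i) p K"
    and surplus: "\<And>i. i < N \<Longrightarrow> surplus K (v i) p = line (v i) (q i) p"
  shows "prefix_revenue v q ord k p \<le> total_revenue N K v (line (v (ord k)) (q (ord k)) p, p)"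
proof -
  let ?H = "line (v (ord k)) (q (ord k)) p"
  have bij: "bij_betw ord {..<N} {..<N}" using ord by (simp add: height_order_def)
  then have inj: "inj_on ord {..k}" using \<open>k < N\<close> by (auto simp: bij_betw_def inj_on_def)
  have lt: "ord j < N" if "j < N" for j using bij that by (auto simp: bij_betw_def)
  have "prefix_revenue v q ord k p = (\<Sum>i\<in>ord ` {..k}. ?H + p * real (q i))"
    by (simp add: prefix_revenue_def sum.reindex[OF inj] sum.distrib sum_distrib_left card_image[OF
        inj])
  also have "\<dots> \<le> total_revenue N K v (?H, p)"
  proof (rule total_revenue_ge)
    show "ord ` {..k} \<subseteq> {..<N}" using lt \<open>k < N\<close> by auto
    show "0 \<le> ?H" using surplus[OF lt[OF \<open>k < N\<close>]] surplus_nonneg by metis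
    fix i assume "i \<in> ord ` {..k}"
    then obtain j where j: "j \<le> k" "i = ord j" by auto
    then have i: "i < N" using lt \<open>k < N\<close> by simp
    show "q i \<le> demand (v i) p K" using q[OF i] .
    show "?H \<le> surplus K (v i) p"
      using ord j \<open>k < N\<close> surplus[OF i] by (cases "j = k") (auto simp: height_order_def)
  qed (use assms in simp)
  finally show ?thesis .
qed

text \<open>Raising the fee to the lowest curve among the buyers loses none of them and increases
  every payment. The buyers form a prefix of the order, and \<open>k\<close> is its last
  position.\<close>

lemma total_revenue_le_prefix_revenue:
  assumes ord: "height_order N v p q ord" and "0 \<le> p\<^sub>1" "0 \<le> p"
    and q: "\<And>i. i < N \<Longrightarrow> q i = demand (v i) p K"
  shows "total_revenue N K v (p\<^sub>1, p) \<le> 0 \<or>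
    (\<exists>k<N. total_revenue N K v (p\<^sub>1, p) \<le> prefix_revenue v q ord k p)"
proof -
  have bij: "bij_betw ord {..<N} {..<N}" using ord by (simp add: height_order_def)
  have lt: "ord j < N" if "j < N" for j using bij that by (auto simp: bij_betw_def)
  define T where "T = {k. k < N \<and> p\<^sub>1 \<le> surplus K (v (ord k)) p}"
  have tot: "total_revenue N K v (p\<^sub>1, p) = (\<Sum>j<N. revenue K (v (ord j)) (p\<^sub>1, p))"
    unfolding total_revenue_def by (rule sum.reindex_bij_betw[OF bij, symmetric])
  also have "\<dots> = (\<Sum>j\<in>T. revenue K (v (ord j)) (p\<^sub>1, p))"
    by (rule sum.mono_neutral_right) (auto simp: T_def revenue_eq_demand[OF \<open>0 \<le> p\<^sub>1\<close>])
  finally have tot: "total_revenue N K v (p\<^sub>1, p) = (\<Sum>j\<in>T. revenue K (v (ord j)) (p\<^sub>1, p))" .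
  show ?thesis
  proof (cases "T = {}")
    case True then show ?thesis using tot by simp
  next
    case False
    have fin: "finite T" by (simp add: T_def)
    define k where "k = Max T"
    have k: "k \<in> T" using Max_in[OF fin False] by (simp add: k_def)
    let ?H = "line (v (ord k)) (q (ord k)) p"
    have H: "p\<^sub>1 \<le> ?H" using k q[OF lt, of k] by (auto simp: T_def surplus_def)
    have T: "T = {..k}"
    proof
      show "T \<subseteq> {..k}" using fin by (auto simp: k_def)
      show "{..k} \<subseteq> T"
      proof
        fix j assume "j \<in> {..k}"
        then have j: "j \<le> k" "j < N" using k by (auto simp: T_def)
        have "?H \<le> line (v (ord j)) (q (ord j)) p"
          using ord j k by (cases "j = k") (auto simp: height_order_def T_def)
        then show "j \<in> T" using H j q[OF lt, of j] by (auto simp: T_def surplus_def)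
      qed
    qed
    have "total_revenue N K v (p\<^sub>1, p) \<le> (\<Sum>j\<le>k. ?H + p * real (q (ord j)))"
      unfolding tot T
    proof (rule sum_mono)
      fix j assume "j \<in> {..k}"
      then have "j < N" using T by (auto simp: T_def)
      then show "revenue K (v (ord j)) (p\<^sub>1, p) \<le> ?H + p * real (q (ord j))"
        using q[OF lt, of j] H assms(2,3) by (auto simp: revenue_eq_demand intro: add_increasing)
    qed
    also have "\<dots> = prefix_revenue v q ord k p"
      by (simp add: prefix_revenue_def sum.distrib sum_distrib_left)
    finally show ?thesis using k by (auto simp: T_def)
  qed
qed

lemma affine_le_max:
  fixes a b x y z :: real
  assumes "x \<le> y" "y \<le> z"
  shows "a + b * y \<le> a + b * x \<or> a + b * y \<le> a + b * z"
  using assms by (cases "0 \<le> b") (auto intro: mult_left_mono mult_left_mono_neg)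

lemma prefix_revenue_le_endpoint:
  assumes "x \<le> y" "y \<le> z"
  shows "prefix_revenue v q ord k y \<le> prefix_revenue v q ord k x \<or>
         prefix_revenue v q ord k y \<le> prefix_revenue v q ord k z"
proof -
  define a where "a = real (Suc k) * ext (v (ord k)) (q (ord k))"
  define b where "b = real (\<Sum>j\<le>k. q (ord j)) - real (Suc k) * real (q (ord k))"
  have "prefix_revenue v q ord k p = a + b * p" for p
    unfolding prefix_revenue_def line_def a_def b_def by (simp add: algebra_simps)
  then show ?thesis using affine_le_max[OF assms, of a b] by simp
qed

section \<open>Events of the sweep\<close>

definition breakpoint :: "(nat \<Rightarrow> real) \<Rightarrow> nat \<Rightarrow> nat \<Rightarrow> real" where
  "breakpoint w q r = (ext w r - ext w q) / (real r - real q)"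

text \<open>The larger quantity has the steeper line and wins to the left of the meeting point. At
  the meeting point itself there is a tie, so the weak and the strict comparison have to be kept
  apart.\<close>

lemma line_le_iff_breakpoint:
  assumes "q < r"
  shows "line w r p \<le> line w q p \<longleftrightarrow> breakpoint w q r \<le> p"
    and "line w r p < line w q p \<longleftrightarrow> breakpoint w q r < p"
  using assms by (simp_all add: line_def breakpoint_def field_simps)

definition crossing :: "(nat \<Rightarrow> nat \<Rightarrow> real) \<Rightarrow> (nat \<Rightarrow> nat) \<Rightarrow> nat \<Rightarrow> nat \<Rightarrow> real" where
  "crossing v q i j = (ext (v j) (q j) - ext (v i) (q i)) / (real (q j) - real (q i))"

lemma line_le_iff_crossing:
  assumes "q i < q j"
  shows "line (v j) (q j) p \<le> line (v i) (q i) p \<longleftrightarrow> crossing v q i j \<le> p"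
    and "line (v j) (q j) p < line (v i) (q i) p \<longleftrightarrow> crossing v q i j < p"
  using assms by (simp_all add: line_def crossing_def field_simps)

text \<open>All meeting points of the current line with steeper ones. For each sample the current
  line is first left at the largest of them; the smaller ones need not be kinks of the
  curve.\<close>

definition breakpoints :: "nat \<Rightarrow> nat \<Rightarrow> (nat \<Rightarrow> nat \<Rightarrow> real) \<Rightarrow> (nat \<Rightarrow> nat) \<Rightarrow> real set" where
  "breakpoints N K v q = {breakpoint (v i) (q i) r |i r. i < N \<and> q i < r \<and> r \<le> K}"

text \<open>When the price falls, a curve rises at the rate \<open>q\<close>. Only a lower neighbour
  with the larger \<open>q\<close> can catch up, and curves further apart cannot swap before some
  neighbours meet.\<close>

definition crossings :: "nat \<Rightarrow> (nat \<Rightarrow> nat \<Rightarrow> real) \<Rightarrow> (nat \<Rightarrow> nat) \<Rightarrow> (nat \<Rightarrow> nat) \<Rightarrow> real set" where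
  "crossings N v q ord =
     {crossing v q (ord k) (ord (Suc k)) |k. Suc k < N \<and> q (ord k) < q (ord (Suc k))}"

definition is_max :: "real \<Rightarrow> real set \<Rightarrow> bool" where
  "is_max x A \<longleftrightarrow> x \<in> A \<and> (\<forall>y\<in>A. y \<le> x)"

text \<open>Sorting ties of height by decreasing quantity makes \<open>ord\<close> correct on a whole interval to the
  left of \<open>e\<close>, and not only at \<open>e\<close> itself.\<close>

definition swept :: "nat \<Rightarrow> nat \<Rightarrow> (nat \<Rightarrow> nat \<Rightarrow> real) \<Rightarrow> real \<Rightarrow> (nat \<Rightarrow> nat) \<Rightarrow> (nat \<Rightarrow> nat) \<Rightarrow> bool" where
  "swept N K v e q ord \<longleftrightarrow> (\<forall>i<N. q i = demand (v i) e K) \<and> height_order N v e q ord \<and>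
     (\<forall>k l. k < l \<longrightarrow> l < N \<longrightarrow>
        line (v (ord k)) (q (ord k)) e = line (v (ord l)) (q (ord l)) e \<longrightarrow> q (ord l) \<le> q (ord k))"

lemma breakpoint_less:
  assumes "swept N K v e q ord" "i < N" "q i < r" "r \<le> K"
  shows "breakpoint (v i) (q i) r < e"
  using assms line_less_demand[of r K "v i" e] line_le_iff_breakpoint(2)[of "q i" r "v i" e]
  by (auto simp: swept_def)

text \<open>Ties of height are sorted by decreasing quantity, so a lower neighbour with the larger
  quantity lies strictly below at \<open>e\<close> and can catch up only later.\<close>

lemma crossing_less:
  assumes "swept N K v e q ord" "Suc k < N" "q (ord k) < q (ord (Suc k))"
  shows "crossing v q (ord k) (ord (Suc k)) < e"
proof -
  have "line (v (ord (Suc k))) (q (ord (Suc k))) e \<le> line (v (ord k)) (q (ord k)) e"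
    "line (v (ord (Suc k))) (q (ord (Suc k))) e \<noteq> line (v (ord k)) (q (ord k)) e"
    using assms unfolding swept_def height_order_def by (metis lessI, metis lessI not_less)
  then show ?thesis using line_le_iff_crossing(2)[of q "ord k" "ord (Suc k)" v e, OF assms(3)]
      by simp
qed

text \<open>Lines of smaller quantities rise more slowly as the price falls and cannot overtake;
  larger quantities are controlled by the breakpoints. The weak hypothesis admits the event
  itself.\<close>

lemma line_le_below:
  assumes sw: "swept N K v e q ord" and "p \<le> e" "i < N" "r \<le> K"
    and ev: "\<And>r. q i < r \<Longrightarrow> r \<le> K \<Longrightarrow> breakpoint (v i) (q i) r \<le> p"
  shows "line (v i) r p \<le> line (v i) (q i) p"
proof (cases "q i < r")
  case True then show ?thesis using ev[OF True] assms(4) line_le_iff_breakpoint(1) by blast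
next
  case False
  have "line (v i) r e \<le> line (v i) (q i) e"
    using sw assms(3,4) line_le_demand[of r K] by (auto simp: swept_def)
  moreover have "(real (q i) - real r) * p \<le> (real (q i) - real r) * e"
    using False \<open>p \<le> e\<close> by (intro mult_left_mono) auto
  ultimately show ?thesis by (simp add: line_def algebra_simps)
qed

lemma demand_const_below:
  assumes sw: "swept N K v e q ord" and "p \<le> e" "i < N"
    and ev: "\<And>r. q i < r \<Longrightarrow> r \<le> K \<Longrightarrow> breakpoint (v i) (q i) r < p"
  shows "demand (v i) p K = q i"
proof (rule demand_eqI)
  show "q i \<le> K" using sw assms(3) demand_le by (auto simp: swept_def)
  show "line (v i) r p \<le> line (v i) (q i) p" if "r \<le> K" for r
    using line_le_below[OF sw assms(2,3) that] ev by (meson less_imp_le)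
  show "line (v i) r p < line (v i) (q i) p" if "r \<le> K" "q i < r" for r
    using ev[OF that(2,1)] line_le_iff_breakpoint(2)[OF that(2)] by blast
qed

text \<open>Comparing neighbours suffices by transitivity. If the upper neighbour has the larger
  quantity, the gap widens to the left; otherwise it closes only at the crossing, where equality
  still respects the order.\<close>

lemma height_order_below:
  assumes sw: "swept N K v e q ord" and "p \<le> e"
    and ev: "\<And>x. x \<in> crossings N v q ord \<Longrightarrow> x \<le> p"
  shows "height_order N v p q ord"
proof -
  let ?h = "\<lambda>k p. line (v (ord k)) (q (ord k)) p"
  have adj: "?h (Suc k) p \<le> ?h k p" if k: "Suc k < N" for k
  proof (cases "q (ord k) < q (ord (Suc k))")
    case True
    then have "crossing v q (ord k) (ord (Suc k)) \<le> p" using k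
        by (intro ev) (auto simp: crossings_def)
    then show ?thesis using line_le_iff_crossing(1)[of q "ord k" "ord (Suc k)", OF True] by blast
  next
    case False
    have "?h (Suc k) e \<le> ?h k e" using sw k by (auto simp: swept_def height_order_def)
    moreover have "(real (q (ord k)) - real (q (ord (Suc k)))) * p \<le>
        (real (q (ord k)) - real (q (ord (Suc k)))) * e"
      using False \<open>p \<le> e\<close> by (intro mult_left_mono) auto
    ultimately show ?thesis by (simp add: line_def algebra_simps)
  qed
  have "l < N \<Longrightarrow> ?h l p \<le> ?h k p" if "k \<le> l" for k l
    using that
  proof (induction rule: dec_induct)
    case base then show ?case by simp
  next
    case (step m) then show ?case using adj[of m] by simp
  qed
  then show ?thesis using sw by (auto simp: swept_def height_order_def)
qed

text \<open>The element 0 is the boundary of the tariffs. It makes the set nonempty, hides negative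
  meeting points and lets the sweep end there.\<close>

definition events :: "nat \<Rightarrow> nat \<Rightarrow> (nat \<Rightarrow> nat \<Rightarrow> real) \<Rightarrow> (nat \<Rightarrow> nat) \<Rightarrow> (nat \<Rightarrow> nat) \<Rightarrow> real set" where
  "events N K v q ord = insert 0 (breakpoints N K v q \<union> crossings N v q ord)"

lemma next_event_less:
  assumes "swept N K v e q ord" "is_max e' (events N K v q ord)" "0 < e"
  shows "e' < e"
  using assms breakpoint_less[OF assms(1)] crossing_less[OF assms(1)]
  by (auto simp: is_max_def events_def breakpoints_def crossings_def)

text \<open>Between two events the set of buyers at a tariff on a fixed curve does not change, so the
  revenue along the curve is affine and bounded by its values at the two events.\<close>

lemma revenue_bound_step:
  assumes sw: "swept N K v e q ord" and mx: "is_max e' (events N K v q ord)" and "e' \<le> e"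
    and "0 \<le> B" "B \<le> B'"
    and at_e: "\<And>\<rho>. \<rho> \<in> tariffs \<Longrightarrow> e \<le> snd \<rho> \<Longrightarrow> total_revenue N K v \<rho> \<le> B"
    and at_e': "\<And>p\<^sub>1. 0 \<le> p\<^sub>1 \<Longrightarrow> total_revenue N K v (p\<^sub>1, e') \<le> B'"
    and \<rho>: "\<rho> \<in> tariffs" "e' \<le> snd \<rho>"
  shows "total_revenue N K v \<rho> \<le> B'"
proof -
  obtain p1 p where rp: "\<rho> = (p1, p)" by (cases \<rho>)
  have p: "0 \<le> p1" "0 \<le> p" "e' \<le> p" using \<rho> rp by (auto simp: tariffs_def)
  have "0 \<le> e'" using mx by (auto simp: is_max_def events_def)
  have br: "breakpoint (v i) (q i) r \<le> e'" if "i < N" "q i < r" "r \<le> K" for i r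
    using mx that by (auto simp: is_max_def events_def breakpoints_def)
  have cr: "x \<le> e'" if "x \<in> crossings N v q ord" for x
    using mx that by (auto simp: is_max_def events_def)
  consider "e \<le> p" | "p = e'" | "e' < p" "p < e" using p by linarith
  then show ?thesis
  proof cases
    case 1 then show ?thesis using at_e[of \<rho>] \<rho> rp \<open>B \<le> B'\<close> by simp
  next
    case 2 then show ?thesis using at_e'[of p1] p rp by simp
  next
    case 3
    have dem: "q i = demand (v i) p K" if "i < N" for i
      using demand_const_below[OF sw, of p i] 3 br that by (smt (verit, best))
    have ordp: "height_order N v p q ord"
      using height_order_below[OF sw, of p] 3 cr by force
    from total_revenue_le_prefix_revenue[OF ordp p(1,2) dem]
    show ?thesis
    proof
      assume "total_revenue N K v (p1, p) \<le> 0" then show ?thesis using rp assms(4,5) by simp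
    next
      assume "\<exists>k<N. total_revenue N K v (p1, p) \<le> prefix_revenue v q ord k p"
      then obtain k where k: "k < N" "total_revenue N K v (p1, p) \<le> prefix_revenue v q ord k p"
          by blast
      \<comment> \<open>On the closed interval the old \<open>q\<close> and \<open>ord\<close> still
        give the true heights, so the formula is dominated by the revenue at an actual tariff. Only
        the two ends are used.\<close>
      have *: "prefix_revenue v q ord k x \<le> total_revenue N K v (line (v (ord k)) (q (ord k)) x, x)
          \<and> 0 \<le> line (v (ord k)) (q (ord k)) x" if x: "e' \<le> x" "x \<le> e" for x
      proof -
        have ordx: "height_order N v x q ord"
          using height_order_below[OF sw, of x] x cr by force
        have le: "line (v i) r x \<le> line (v i) (q i) x" if "i < N" "r \<le> K" for i r
          using line_le_below[OF sw x(2) that] br[OF that(1)] x(1) by force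
        have qK: "q i \<le> K" if "i < N" for i using sw that demand_le by (auto simp: swept_def)
        have tp: "surplus K (v i) x = line (v i) (q i) x" if "i < N" for i
          unfolding surplus_def using le[OF that demand_le,
              of "v i" x] line_le_demand[OF qK[OF that], of "v i" x] by simp
        have "ord k < N" using ordx k by (auto simp: height_order_def bij_betw_def)
        then have "0 \<le> line (v (ord k)) (q (ord k)) x" using tp surplus_nonneg by metis
        moreover have "prefix_revenue v q ord k x \<le>
            total_revenue N K v (line (v (ord k)) (q (ord k)) x, x)"
          using prefix_revenue_le[OF ordx k(1), where K = K] tp demand_ge[OF qK le] x \<open>0 \<le> e'\<close>
              by simp
        ultimately show ?thesis by blast
      qed
      have "prefix_revenue v q ord k e \<le> B'"
        using *[of e] at_e[of "(line (v (ord k)) (q (ord k)) e, e)"] assms(3,5) \<open>0 \<le> e'\<close>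
        by (auto simp: tariffs_def)
      moreover have "prefix_revenue v q ord k e' \<le> B'"
        using *[of e'] at_e'[of "line (v (ord k)) (q (ord k)) e'"] assms(3) by auto
      ultimately show ?thesis
        using prefix_revenue_le_endpoint[of e' p e v q ord k] 3 k rp by force
    qed
  qed
qed

section \<open>Charging events to pieces\<close>

text \<open>The supremum of the second coordinate over some piece, except that the piece may depend on
  how closely \<open>e\<close> is approached. This is still enough to count such values by pieces, and it avoids
  showing that a whole piece accumulates at \<open>e\<close>.\<close>

definition piece_end :: "nat \<Rightarrow> nat \<Rightarrow> (nat \<Rightarrow> nat \<Rightarrow> real) \<Rightarrow> real \<Rightarrow> bool" where
  "piece_end N K v e \<longleftrightarrow> (\<forall>x<e. \<exists>\<rho>\<in>tariffs. x < snd \<rho> \<and>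
     (\<forall>\<sigma>. (\<rho>, \<sigma>) \<in> same_purchases N K v \<longrightarrow> snd \<sigma> \<le> e))"

lemma same_purchases_refl: "\<rho> \<in> tariffs \<Longrightarrow> (\<rho>, \<rho>) \<in> same_purchases N K v"
  by (auto simp: same_purchases_def)

text \<open>Each end in \<open>F\<close> gets a witness lying above the preceding end in
  \<open>F\<close>. The piece of the smaller of two ends stops at that end, so it cannot contain the
  witness of the larger one.\<close>

lemma card_piece_ends_aux:
  assumes fin: "finite F" and F: "F \<subseteq> {e. piece_end N K v e}"
  shows "card F \<le> card (pieces N K v)"
proof -
  \<comment> \<open>The predecessor of \<open>e\<close> in \<open>F\<close>; the value
    \<open>e - 1\<close> only makes the maximum meaningful for the least element.\<close>
  define m where "m e = Max (insert (e - 1) {x \<in> F. x < e})" for e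
  have m_less: "m e < e" for e unfolding m_def using fin by (subst Max_less_iff) auto
  have m_ge: "x \<le> m e" if "x \<in> F" "x < e" for x e unfolding m_def using fin that
      by (intro Max_ge) auto
  have "\<forall>e\<in>F. \<exists>\<rho>. \<rho> \<in> tariffs \<and> m e < snd \<rho> \<and> (\<forall>\<sigma>. (\<rho>, \<sigma>) \<in> same_purchases N K v \<longrightarrow> snd \<sigma> \<le> e)"
    using F m_less by (force simp: piece_end_def)
  then obtain w where w: "\<And>e. e \<in> F \<Longrightarrow> w e \<in> tariffs" "\<And>e. e \<in> F \<Longrightarrow> m e < snd (w e)"
    "\<And>e \<sigma>. e \<in> F \<Longrightarrow> (w e, \<sigma>) \<in> same_purchases N K v \<Longrightarrow> snd \<sigma> \<le> e"
    by metis
  let ?P = "\<lambda>e. same_purchases N K v `` {w e}"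
  have less: "?P x \<noteq> ?P y" if "x \<in> F" "y \<in> F" "x < y" for x y
  proof
    assume "?P x = ?P y"
    then have "(w x, w y) \<in> same_purchases N K v" using same_purchases_refl[OF w(1)[OF that(2)]]
        by blast
    then have "snd (w y) \<le> x" using w(3) that by blast
    then show False using w(2)[OF that(2)] m_ge[OF that(1,3)] by simp
  qed
  have "inj_on ?P F" by (rule inj_onI) (metis less linorder_neqE)
  moreover have "?P ` F \<subseteq> pieces N K v" using w(1) by (auto simp: pieces_def quotientI)
  ultimately show ?thesis using finite_pieces by (rule card_inj_on_le)
qed

text \<open>Finiteness needs its own argument because \<open>card\<close> of an infinite set is 0.
  It follows from the bound for finite subsets, applied to one with too many elements.\<close>

lemma piece_ends_le:
  shows finite_piece_ends: "finite {e. piece_end N K v e}"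
    and card_piece_ends: "card {e. piece_end N K v e} \<le> card (pieces N K v)"
proof -
  show *: "finite {e. piece_end N K v e}"
  proof (rule ccontr)
    assume "infinite {e. piece_end N K v e}"
    then obtain F where "finite F" "card F = Suc (card (pieces N K v))" "F \<subseteq> {e. piece_end N K v e}"
      using infinite_arbitrarily_large by blast
    then show False using card_piece_ends_aux by fastforce
  qed
  show "card {e. piece_end N K v e} \<le> card (pieces N K v)"
    using card_piece_ends_aux[OF *] by blast
qed

text \<open>At a breakpoint of sample \<open>i\<close> the witness is the tariff \<open>(0, e')\<close>. At a crossing of two curves
  it lies on the upper curve just left of the crossing: there one of the two samples buys
      and the other
  does not, which is impossible to the right of the crossing.\<close>

lemma next_event_piece_end:
  assumes sw: "swept N K v e q ord" and mx: "is_max e' (events N K v q ord)" and "0 < e'" "e' \<le> e"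
  shows "piece_end N K v e'"
proof -
  have br: "breakpoint (v i) (q i) r \<le> e'" if "i < N" "q i < r" "r \<le> K" for i r
    using mx that by (auto simp: is_max_def events_def breakpoints_def)
  have qK: "q i \<le> K" if "i < N" for i using sw that demand_le by (auto simp: swept_def)
  show ?thesis
  proof (cases "e' \<in> breakpoints N K v q")
    case True
    then obtain i r where ir: "i < N" "q i < r" "r \<le> K" "e' = breakpoint (v i) (q i) r"
      by (auto simp: breakpoints_def)
    let ?d = "demand (v i) e' K"
    have le: "line (v i) x e' \<le> line (v i) (q i) e'" if "x \<le> K" for x
      using line_le_below[OF sw assms(4) ir(1) that] br[OF ir(1)] by blast
    have "line (v i) (q i) e' \<le> line (v i) r e'"
      using line_le_iff_breakpoint(2)[OF ir(2), of "v i" e'] ir(4) by simp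
    then have "r \<le> ?d" using demand_ge[OF ir(3)] le by (meson order_trans)
    then have qd: "q i < ?d" using ir by simp
    \<comment> \<open>Several lines may meet at \<open>e'\<close>, so the new demand need not be
      \<open>r\<close>; its line still meets the old one exactly there.\<close>
    have tie: "breakpoint (v i) (q i) ?d = e'"
      using line_le_iff_breakpoint[OF qd, of "v i" e'] le[OF demand_le,
          of "v i" e'] line_le_demand[OF qK[OF ir(1)], of "v i" e']
      by simp
    have "snd \<sigma> \<le> e'" if "((0, e'), \<sigma>) \<in> same_purchases N K v" for \<sigma>
    proof -
      obtain s1 s2 where s: "\<sigma> = (s1, s2)" by (cases \<sigma>)
      have s1: "0 \<le> s1" and eq: "purchase K (v i) (0, e') = purchase K (v i) (s1, s2)"
        using that ir(1) s by (auto simp: same_purchases_def tariffs_def)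
      have "purchase K (v i) (0, e') = ?d" using surplus_nonneg[of K "v i" e']
          by (simp add: purchase_eq_demand)
      then have "demand (v i) s2 K = ?d" using eq qd s1
          by (auto simp: purchase_eq_demand split: if_splits)
      then have "line (v i) (q i) s2 \<le> line (v i) ?d s2"
          using line_le_demand[OF qK[OF ir(1)], of "v i" s2] by simp
      then show ?thesis using line_le_iff_breakpoint(2)[OF qd, of "v i" s2] tie s by simp
    qed
    moreover have "(0, e') \<in> tariffs" using \<open>0 < e'\<close> by (simp add: tariffs_def)
    ultimately show ?thesis unfolding piece_end_def by (metis snd_conv)
  next
    case False
    then obtain k where k: "Suc k < N" "q (ord k) < q (ord (Suc k))" "e' =
        crossing v q (ord k) (ord (Suc k))"
      using mx \<open>0 < e'\<close> by (auto simp: is_max_def events_def crossings_def)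
    define a where "a = ord k"
    define b where "b = ord (Suc k)"
    have ab: "a < N" "b < N" "q a < q b" "e' = crossing v q a b"
      using sw k by (auto simp: a_def b_def swept_def height_order_def bij_betw_def)
    have finB: "finite (breakpoints N K v q)"
    proof -
      have "breakpoints N K v q \<subseteq> (\<lambda>(i, r). breakpoint (v i) (q i) r) ` ({..<N} \<times> {..K})"
        by (force simp: breakpoints_def)
      then show ?thesis by (rule finite_subset) simp
    qed
    have lt: "\<forall>y\<in>breakpoints N K v q. y < e'"
      using False mx unfolding is_max_def events_def by (metis UnCI insertCI order_less_le)
    show ?thesis unfolding piece_end_def
    proof (intro allI impI)
      fix x assume "x < e'"
      \<comment> \<open>Above this maximum no breakpoint is left, so at the chosen \<open>p\<close>
        the demand is still \<open>q\<close>; 0 keeps the price positive and \<open>x\<close> keeps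
        the witness close to \<open>e'\<close>.\<close>
      let ?m = "Max (insert 0 (insert x (breakpoints N K v q)))"
      have "?m < e'" using finB lt \<open>x < e'\<close> \<open>0 < e'\<close> by (subst Max_less_iff) auto
      then obtain p where p: "?m < p" "p < e'" using dense by blast
      then have p': "0 < p" "x < p" "\<forall>y\<in>breakpoints N K v q. y < p" using finB
          by (auto simp: Max_less_iff)
      have dem: "demand (v i) p K = q i" if "i < N" for i
        using demand_const_below[OF sw, of p i] p(2) assms(4) p'(3) that
            by (force simp: breakpoints_def)
      have lab: "line (v a) (q a) p < line (v b) (q b) p"
        using line_le_iff_crossing(1)[of q a b v p, OF ab(3)] ab(4) p(2) by simp
      let ?\<rho> = "(line (v b) (q b) p, p)"
      have H0: "0 \<le> line (v b) (q b) p" using surplus_nonneg[of K "v b" p] dem ab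
          by (simp add: surplus_def)
      have "snd \<sigma> \<le> e'" if "(?\<rho>, \<sigma>) \<in> same_purchases N K v" for \<sigma>
      proof -
        obtain s1 s2 where s: "\<sigma> = (s1, s2)" by (cases \<sigma>)
        have s1: "0 \<le> s1" and eq: "\<And>i. i < N \<Longrightarrow> purchase K (v i) ?\<rho> = purchase K (v i) (s1, s2)"
          using that s by (auto simp: same_purchases_def tariffs_def)
        have "purchase K (v a) (s1, s2) = 0"
          using eq[OF ab(1)] dem ab lab H0 by (simp add: purchase_eq_demand surplus_def)
        \<comment> \<open>Buying nothing means that the fee exceeds the surplus or that the demand
          is 0; in the latter case the surplus is 0 and the fee nonnegative.\<close>
        then have "surplus K (v a) s2 \<le> s1" using s1
          by (auto simp: purchase_eq_demand surplus_def line_def ext_def split: if_splits)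
        then have a: "line (v a) (q a) s2 \<le> s1" using line_le_surplus[OF qK[OF ab(1)], of "v a" s2]
            by simp
        have "purchase K (v b) (s1, s2) = q b"
          using eq[OF ab(2)] dem ab H0 by (simp add: purchase_eq_demand surplus_def)
        then have "s1 \<le> line (v b) (q b) s2" using s1 ab(3)
          by (auto simp: purchase_eq_demand surplus_def split: if_splits)
        then show ?thesis using a line_le_iff_crossing(2)[of q a b v s2, OF ab(3)] ab(4) s by simp
      qed
      then show "\<exists>\<rho>\<in>tariffs. x < snd \<rho> \<and> (\<forall>\<sigma>. (\<rho>, \<sigma>) \<in> same_purchases N K v \<longrightarrow> snd \<sigma> \<le> e')"
        using p' H0 by (intro bexI[of _ ?\<rho>]) (auto simp: tariffs_def)
    qed
  qed
qed

section \<open>Timed executions\<close>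

definition runs :: "com \<Rightarrow> state \<Rightarrow> nat \<Rightarrow> (state \<Rightarrow> bool) \<Rightarrow> bool" where
  "runs c s T Q \<longleftrightarrow> (\<exists>t s'. exec c s t s' \<and> t \<le> T \<and> Q s')"

lemma runs_mono: "runs c s T Q \<Longrightarrow> (\<And>s'. Q s' \<Longrightarrow> Q' s') \<Longrightarrow> T \<le> T' \<Longrightarrow> runs c s T' Q'"
  by (fastforce simp: runs_def)

lemma runs_Seq:
  assumes "runs c s T1 P" "\<And>s'. P s' \<Longrightarrow> runs d s' T2 Q" "T1 + T2 \<le> T"
  shows "runs (Seq c d) s T Q"
proof -
  obtain t1 s1 where 1: "exec c s t1 s1" "t1 \<le> T1" "P s1" using assms(1) by (auto simp: runs_def)
  obtain t2 s2 where 2: "exec d s1 t2 s2" "t2 \<le> T2" "Q s2" using assms(2)[OF 1(3)]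
      by (auto simp: runs_def)
  show ?thesis unfolding runs_def
    using exec.Seq[OF 1(1) 2(1)] 1 2 assms(3) by (intro exI[of _ "t1 + t2"] exI[of _ s2]) auto
qed

lemma runs_WhileFalse: "\<not> bval b s \<Longrightarrow> Q s \<Longrightarrow> runs (While b c) s (bcost b + 1) Q"
  unfolding runs_def using exec.WhileFalse by blast

lemma runs_WhileTrue:
  assumes "bval b s" "runs c s T1 P" "\<And>s'. P s' \<Longrightarrow>
      runs (While b c) s' T2 Q" "bcost b + 1 + T1 + T2 \<le> T"
  shows "runs (While b c) s T Q"
proof -
  obtain t1 s1 where 1: "exec c s t1 s1" "t1 \<le> T1" "P s1" using assms(2) by (auto simp: runs_def)
  obtain t2 s2 where 2: "exec (While b c) s1 t2 s2" "t2 \<le> T2" "Q s2"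
    using assms(3)[OF 1(3)] by (auto simp: runs_def)
  show ?thesis unfolding runs_def
    using exec.WhileTrue[OF assms(1) 1(1) 2(1)] 1 2 assms(4)
    by (intro exI[of _ "bcost b + 1 + t1 + t2"] exI[of _ s2]) auto
qed

section \<open>Loop-free code, counted loops and frame conditions\<close>

primrec loop_free :: "com \<Rightarrow> bool" where
  "loop_free Skip \<longleftrightarrow> True"
| "loop_free (NWrite a e f) \<longleftrightarrow> True"
| "loop_free (RWrite a e f) \<longleftrightarrow> True"
| "loop_free (Seq c d) \<longleftrightarrow> loop_free c \<and> loop_free d"
| "loop_free (If b c d) \<longleftrightarrow> loop_free c \<and> loop_free d"
| "loop_free (While b c) \<longleftrightarrow> False"

primrec run :: "com \<Rightarrow> state \<Rightarrow> state" where
  "run Skip s = s"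
| "run (NWrite a e f) s = write_nat a (nval e s) (nval f s) s"
| "run (RWrite a e f) s = write_real a (nval e s) (rval f s) s"
| "run (Seq c d) s = run d (run c s)"
| "run (If b c d) s = (if bval b s then run c s else run d s)"
| "run (While b c) s = s"

text \<open>Adding both branches instead of taking their maximum is generous, but makes concrete
  bounds plain sums. The value for loops is a dummy excluded by \<open>loop_free\<close>.\<close>

primrec max_time :: "com \<Rightarrow> nat" where
  "max_time Skip = 1"
| "max_time (NWrite a e f) = ncost e + ncost f + 1"
| "max_time (RWrite a e f) = ncost e + rcost f + 1"
| "max_time (Seq c d) = max_time c + max_time d"
| "max_time (If b c d) = bcost b + 1 + (max_time c + max_time d)"
| "max_time (While b c) = 0"

lemma exec_loop_free: "loop_free c \<Longrightarrow> \<exists>t\<le>max_time c. exec c s t (run c s)"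
proof (induction c arbitrary: s)
  case Skip show ?case using exec.Skip by (intro exI[of _ 1]) simp
next
  case (NWrite a e f) show ?case using exec.NWrite by fastforce
next
  case (RWrite a e f) show ?case using exec.RWrite by fastforce
next
  case (Seq c d)
  then obtain t1 t2 where "t1 \<le> max_time c" "exec c s t1 (run c s)"
    "t2 \<le> max_time d" "exec d (run c s) t2 (run d (run c s))" by fastforce
  then show ?case using exec.Seq by (intro exI[of _ "t1 + t2"]) auto
next
  case (If b c d)
  show ?case
  proof (cases "bval b s")
    case True
    obtain t where "t \<le> max_time c" "exec c s t (run c s)" using If by fastforce
    then show ?thesis using True exec.IfTrue by (intro exI[of _ "bcost b + 1 + t"]) auto
  next
    case False
    obtain t where "t \<le> max_time d" "exec d s t (run d s)" using If by fastforce
    then show ?thesis using False exec.IfFalse by (intro exI[of _ "bcost b + 1 + t"]) auto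
  qed
qed simp

lemma runs_loop_free: "loop_free c \<Longrightarrow> max_time c \<le> T \<Longrightarrow> Q (run c s) \<Longrightarrow> runs c s T Q"
  unfolding runs_def using exec_loop_free[of c s] order_trans by blast

abbreviation nvar :: "arr \<Rightarrow> nexp" where "nvar x \<equiv> NRead x (NConst 0)"
abbreviation rvar :: "arr \<Rightarrow> rexp" where "rvar x \<equiv> RRead x (NConst 0)"

definition For :: "arr \<Rightarrow> nexp \<Rightarrow> com \<Rightarrow> com" where
  "For x b c = Seq (NWrite x (NConst 0) (NConst 0))
     (While (NLess (nvar x) b) (Seq c (NWrite x (NConst 0) (NAdd (nvar x) (NConst 1)))))"

text \<open>The invariant is asserted after the counter update, so it need not mention the counter.
  Each round costs \<open>ncost b + 4\<close> for the test and 6 for the increment; the first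
  assignment and the failing test account for \<open>ncost b + 7\<close>.\<close>

lemma runs_For:
  assumes init: "I 0 (write_nat x 0 0 s)"
    and step: "\<And>k s'. k < n \<Longrightarrow> I k s' \<Longrightarrow> nats s' x 0 = k \<Longrightarrow>
      runs c s' T (\<lambda>s''. nats s'' x 0 = k \<and> I (Suc k) (write_nat x 0 (Suc k) s''))"
    and bound: "\<And>k s'. I k s' \<Longrightarrow> nval b s' = n"
    and time: "ncost b + 7 + n * (T + ncost b + 10) \<le> T'"
  shows "runs (For x b c) s T' (I n)"
proof -
  let ?W = "While (NLess (nvar x) b) (Seq c (NWrite x (NConst 0) (NAdd (nvar x) (NConst 1))))"
  have W: "runs ?W s' (ncost b + 4 + d * (T + ncost b + 10)) (I n)"
    if "I k s'" "nats s' x 0 = k" "k + d = n" for d k s'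
    using that
  proof (induction d arbitrary: k s')
    case 0
    have "\<not> bval (NLess (nvar x) b) s'" using 0 bound by simp
    then have "exec ?W s' (bcost (NLess (nvar x) b) + 1) s'" by (rule exec.WhileFalse)
    then show ?case using 0 unfolding runs_def by (intro exI conjI) auto
  next
    case (Suc d)
    have "k < n" using Suc by simp
    from step[OF this Suc.prems(1,2)] obtain t s1
        where 1: "exec c s' t s1" "t \<le> T" "nats s1 x 0 = k"
      "I (Suc k) (write_nat x 0 (Suc k) s1)" by (auto simp: runs_def)
    have "exec (NWrite x (NConst 0) (NAdd (nvar x) (NConst 1))) s1 6 (write_nat x 0 (Suc k) s1)"
      using exec.NWrite[of x "NConst 0" "NAdd (nvar x) (NConst 1)" s1] 1(3)
          by (simp add: eval_nat_numeral)
    note 2 = exec.Seq[OF 1(1) this]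
    have b: "bval (NLess (nvar x) b) s'" using Suc.prems bound by simp
    have "runs ?W (write_nat x 0 (Suc k) s1) (ncost b + 4 + d * (T + ncost b + 10)) (I n)"
      using Suc.prems 1 by (intro Suc.IH[of "Suc k"]) (auto simp: write_nat_def)
    then obtain t' s2 where 3: "exec ?W (write_nat x 0 (Suc k) s1) t' s2"
      "t' \<le> ncost b + 4 + d * (T + ncost b + 10)" "I n s2" by (auto simp: runs_def)
    show ?case unfolding runs_def using exec.WhileTrue[OF b 2 3(1)] 1 3
      by (intro exI conjI) auto
  qed
  show ?thesis unfolding For_def
  proof (rule runs_Seq)
    show "runs (NWrite x (NConst 0) (NConst 0)) s 3 (\<lambda>s'. I 0 s' \<and> nats s' x 0 = 0)"
      using init by (intro runs_loop_free) (auto simp: write_nat_def)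
    show "runs ?W s' (ncost b + 4 + n * (T + ncost b + 10)) (I n)" if "I 0 s' \<and>
        nats s' x 0 = 0" for s'
      using that W[of 0 s' n] by simp
    show "3 + (ncost b + 4 + n * (T + ncost b + 10)) \<le> T'" using time by simp
  qed
qed

lemma nats_write_nat [simp]: "nats (write_nat a i x s) = (nats s)(a := (nats s a)(i := x))"
  and reals_write_nat [simp]: "reals (write_nat a i x s) = reals s"
  and reals_write_real [simp]: "reals (write_real a i y s) = (reals s)(a := (reals s a)(i := y))"
  and nats_write_real [simp]: "nats (write_real a i y s) = nats s"
  by (simp_all add: write_nat_def write_real_def)

text \<open>Frame condition: \<open>A\<close> and \<open>B\<close> list the arrays of naturals and
  of reals that may have changed.\<close>

definition same_except :: "arr set \<Rightarrow> arr set \<Rightarrow> state \<Rightarrow> state \<Rightarrow> bool" where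
  "same_except A B s s' \<longleftrightarrow> (\<forall>a. a \<notin> A \<longrightarrow> nats s' a = nats s a) \<and> (\<forall>a. a \<notin> B \<longrightarrow> reals s' a = reals s a)"

lemma same_except_refl [simp]: "same_except A B s s"
  by (simp add: same_except_def)

lemma same_except_trans:
  "same_except A B s s' \<Longrightarrow> same_except A' B' s' s'' \<Longrightarrow> A \<subseteq> C \<Longrightarrow> A' \<subseteq> C \<Longrightarrow> B \<subseteq> D \<Longrightarrow> B' \<subseteq> D \<Longrightarrow>
    same_except C D s s''"
  unfolding same_except_def
proof (intro conjI allI impI; elim conjE)
  fix a assume "a \<notin> C" "A \<subseteq> C" "A' \<subseteq> C" "\<forall>a. a \<notin> A \<longrightarrow> nats s' a = nats s a"
    "\<forall>a. a \<notin> A' \<longrightarrow> nats s'' a = nats s' a"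
  then have "nats s' a = nats s a" "nats s'' a = nats s' a" by blast+
  then show "nats s'' a = nats s a" by simp
next
  fix a assume "a \<notin> D" "B \<subseteq> D" "B' \<subseteq> D" "\<forall>a. a \<notin> B \<longrightarrow> reals s' a = reals s a"
    "\<forall>a. a \<notin> B' \<longrightarrow> reals s'' a = reals s' a"
  then have "reals s' a = reals s a" "reals s'' a = reals s' a" by blast+
  then show "reals s'' a = reals s a" by simp
qed

lemma same_except_write [simp]:
  "a \<in> A \<Longrightarrow> same_except A B s (write_nat a i x s') \<longleftrightarrow> same_except A B s s'"
  "b \<in> B \<Longrightarrow> same_except A B s (write_real b i y s') \<longleftrightarrow> same_except A B s s'"
  by (auto simp: same_except_def)

section \<open>Bucket sort\<close>

text \<open>The index breaks the remaining ties, in the order in which the inner sorting loop meets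
  the samples. The order is thereby total, ranks are distinct, and a rank is a final
  position.\<close>

definition precedes :: "(nat \<Rightarrow> real) \<Rightarrow> (nat \<Rightarrow> nat) \<Rightarrow> nat \<Rightarrow> nat \<Rightarrow> bool" where
  "precedes h q i j \<longleftrightarrow> h j < h i \<or> h i = h j \<and> (q j < q i \<or> q i = q j \<and> i < j)"

definition rank :: "nat \<Rightarrow> (nat \<Rightarrow> real) \<Rightarrow> (nat \<Rightarrow> nat) \<Rightarrow> nat \<Rightarrow> nat" where
  "rank N h q j = card {i. i < N \<and> precedes h q i j}"

lemma precedes_total: "i \<noteq> j \<Longrightarrow> precedes h q i j \<or> precedes h q j i"
  by (auto simp: precedes_def)

lemma rank_mono: "i < N \<Longrightarrow> precedes h q i j \<Longrightarrow> rank N h q i < rank N h q j"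
proof -
  assume i: "i < N" "precedes h q i j"
  have "precedes h q k j" if "precedes h q k i" for k
    using that i(2) by (auto simp: precedes_def)
  moreover have "\<not> precedes h q i i" by (simp add: precedes_def)
  ultimately have "{k. k < N \<and> precedes h q k i} \<subset> {k. k < N \<and> precedes h q k j}"
    using i by blast
  then show ?thesis unfolding rank_def by (intro psubset_card_mono) simp_all
qed

lemma rank_less: "j < N \<Longrightarrow> rank N h q j < N"
proof -
  assume "j < N"
  then have "{i. i < N \<and> precedes h q i j} \<subset> {..<N}" by (auto simp: precedes_def)
  then have "card {i. i < N \<and> precedes h q i j} < card {..<N}" by (intro psubset_card_mono) simp_all
  then show ?thesis by (simp add: rank_def)
qed

lemma inj_on_rank: "inj_on (rank N h q) {..<N}"
proof (rule inj_onI)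
  fix i j assume ij: "i \<in> {..<N}" "j \<in> {..<N}" "rank N h q i = rank N h q j"
  then show "i = j"
    using rank_mono[of i N h q j] rank_mono[of j N h q i] precedes_total[of i j h q] by auto
qed

lemma sorted_by_rank:
  assumes "\<And>j. j < N \<Longrightarrow> ord (rank N h q j) = j"
  shows "bij_betw ord {..<N} {..<N}"
    and "k < l \<Longrightarrow> l < N \<Longrightarrow> precedes h q (ord k) (ord l)"
proof -
  have bij: "bij_betw (rank N h q) {..<N} {..<N}"
    unfolding bij_betw_def using inj_on_rank rank_less
    by (metis (no_types, lifting) endo_inj_surj finite_lessThan image_subset_iff lessThan_iff)
  have ex: "\<exists>j<N. k = rank N h q j" if "k < N" for k
    using bij that by (auto simp: bij_betw_def)
  show "bij_betw ord {..<N} {..<N}"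
  proof (rule bij_betw_byWitness[where f' = "rank N h q"])
    show "\<forall>a\<in>{..<N}. rank N h q (ord a) = a" using ex assms by (metis lessThan_iff)
    show "\<forall>a\<in>{..<N}. ord (rank N h q a) = a" using assms by simp
    show "ord ` {..<N} \<subseteq> {..<N}" using ex assms by force
    show "rank N h q ` {..<N} \<subseteq> {..<N}" using rank_less by auto
  qed
  show "precedes h q (ord k) (ord l)" if "k < l" "l < N"
  proof -
    obtain i j where ij: "i < N" "k = rank N h q i" "j < N" "l = rank N h q j"
      using ex[of k] ex[of l] \<open>k < l\<close> \<open>l < N\<close> by auto
    then have "\<not> precedes h q j i" "i \<noteq> j" using rank_mono[of j N h q i] that by auto
    then show ?thesis using ij assms precedes_total by metis
  qed
qed

text \<open>The first position of the block of samples as high as \<open>j\<close>, used as the name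
  of that block.\<close>

definition num_above :: "nat \<Rightarrow> (nat \<Rightarrow> real) \<Rightarrow> nat \<Rightarrow> nat" where
  "num_above N h j = card {i. i < N \<and> h j < h i}"

lemma num_above_less: "j' < N \<Longrightarrow> h j < h j' \<Longrightarrow> num_above N h j' < num_above N h j"
proof -
  assume j: "j' < N" "h j < h j'"
  have "{i. i < N \<and> h j' < h i} \<subseteq> {i. i < N \<and> h j < h i}" using j by auto
  moreover have "j' \<in> {i. i < N \<and> h j < h i}" "j' \<notin> {i. i < N \<and> h j' < h i}" using j by auto
  ultimately have "{i. i < N \<and> h j' < h i} \<subset> {i. i < N \<and> h j < h i}" by blast
  then show ?thesis unfolding num_above_def by (intro psubset_card_mono) simp_all
qed

lemma num_above_eq_iff:
  assumes "i < N" "j < N" shows "num_above N h i = num_above N h j \<longleftrightarrow> h i = h j"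
proof
  show "num_above N h i = num_above N h j \<Longrightarrow> h i = h j"
    using num_above_less[OF assms(1), of h j] num_above_less[OF assms(2), of h i]
        by (cases "h i" "h j" rule: linorder_cases) auto
qed (simp add: num_above_def)

text \<open>Where the height drops strictly, the samples above are exactly those at earlier
  positions.\<close>

lemma num_above_first:
  assumes "bij_betw ord {..<N} {..<N}" "\<And>k l. k < l \<Longrightarrow> l < N \<Longrightarrow> h (ord l) \<le> h (ord k)"
    and "k < N" "\<And>l. l < k \<Longrightarrow> h (ord k) < h (ord l)"
  shows "num_above N h (ord k) = k"
proof -
  have "{i. i < N \<and> h (ord k) < h i} = ord ` {..<k}"
  proof
    show "{i. i < N \<and> h (ord k) < h i} \<subseteq> ord ` {..<k}"
    proof
      fix i assume i: "i \<in> {i. i < N \<and> h (ord k) < h i}"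
      then obtain l where l: "l < N" "i = ord l" using assms(1) by (auto simp: bij_betw_def)
      then have "\<not> k \<le> l" using i assms(2)[of k l] by (auto simp: le_less)
      then show "i \<in> ord ` {..<k}" using l by auto
    qed
    show "ord ` {..<k} \<subseteq> {i. i < N \<and> h (ord k) < h i}"
      using assms(1,3,4) by (auto simp: bij_betw_def)
  qed
  moreover have "inj_on ord {..<k}" using assms(1,3) by (auto simp: bij_betw_def inj_on_def)
  ultimately show ?thesis by (simp add: num_above_def card_image)
qed

text \<open>\<open>D\<close> is the set of samples placed so far, and \<open>ptr\<close> maps the first position of every block
  of equal heights to the next free position of that block.\<close>

definition bucketed :: "nat \<Rightarrow> (nat \<Rightarrow> real) \<Rightarrow> (nat \<Rightarrow> nat) \<Rightarrow> nat set \<Rightarrow> (nat \<Rightarrow> nat) \<Rightarrow> (nat \<Rightarrow> nat) \<Rightarrow>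
    bool" where
  "bucketed N h q D ptr ord \<longleftrightarrow>
     (\<forall>j<N. ptr (num_above N h j) = num_above N h j + card {i \<in> D. h i = h j}) \<and>
     (\<forall>j\<in>D. ord (rank N h q j) = j)"

text \<open>If the samples already placed in the block of \<open>j\<close> are exactly its
  predecessors there, the free position of the block is the rank of \<open>j\<close>. Nothing is
  asked about which samples of other blocks have been placed.\<close>

lemma bucketed_insert:
  assumes b: "bucketed N h q D ptr ord" and D: "D \<subseteq> {..<N}" "j < N" "j \<notin> D"
    and before: "\<And>i. i < N \<Longrightarrow> i \<in> D \<and> h i = h j \<longleftrightarrow> h i = h j \<and> (q j < q i \<or> q i = q j \<and> i < j)"
  shows "bucketed N h q (insert j D) (ptr(num_above N h j := Suc (ptr (num_above N h j)))) (ord(ptr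
      (num_above N h j) := j))"
proof -
  have fin: "finite D" using D finite_subset by blast
  have "{i. i < N \<and> precedes h q i j} = {i. i < N \<and> h j < h i} \<union> {i \<in> D. h i = h j}"
    using before D(1) by (auto simp: precedes_def)
  moreover have "card ({i. i < N \<and> h j < h i} \<union> {i \<in> D. h i = h j}) =
      num_above N h j + card {i \<in> D. h i = h j}"
    unfolding num_above_def by (rule card_Un_disjoint) (use fin in auto)
  ultimately have "rank N h q j = num_above N h j + card {i \<in> D. h i = h j}"
    by (simp add: rank_def)
  then have ptr: "ptr (num_above N h j) = rank N h q j" using b D by (simp add: bucketed_def)
  have card: "card {i \<in> insert j D. h i = h j2} = (if h j = h j2 then Suc (card {i \<in> D. h i =
      h j2}) else card {i \<in> D. h i = h j2})" for j2
  proof (cases "h j = h j2")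
    case True
    then have "{i \<in> insert j D. h i = h j2} = insert j {i \<in> D. h i = h j2}" by auto
    then show ?thesis using True fin D(3) by simp
  next
    case False
    then have "{i \<in> insert j D. h i = h j2} = {i \<in> D. h i = h j2}" by auto
    then show ?thesis using False by simp
  qed
  have neq: "rank N h q j2 \<noteq> rank N h q j" if "j2 \<in> D" for j2
    using that D inj_on_rank[of N h q] by (metis inj_onD lessThan_iff subset_iff)
  have eq: "num_above N h k = num_above N h j \<longleftrightarrow> h k = h j" if "k < N" for k
    using num_above_eq_iff[OF that D(2)] .
  show ?thesis unfolding bucketed_def card
  proof (intro conjI allI impI ballI)
    fix k assume k: "k < N"
    have "ptr (num_above N h k) = num_above N h k + card {i \<in> D. h i = h k}"
      using b k by (simp add: bucketed_def)
    then show "(ptr(num_above N h j := Suc (ptr (num_above N h j)))) (num_above N h k) =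
      num_above N h k + (if h j = h k then Suc (card {i \<in> D. h i = h k}) else card {i \<in> D. h i =
          h k})"
      using eq[OF k] by (cases "h k = h j") auto
  next
    fix k assume "k \<in> insert j D"
    then show "(ord(ptr (num_above N h j) := j)) (rank N h q k) = k"
      using b neq ptr by (auto simp: bucketed_def)
  qed
qed

section \<open>The program\<close>

text \<open>For sample \<open>i\<close>, the cell \<open>q[i]\<close> holds its demand, \<open>c[i]\<close> the value of that demand, \<open>h[i]\<close> its
  surplus at the current event \<open>e\<close>, and \<open>o[i] = i * K\<close> the offset of its row in \<open>v\<close>, which is
  tabulated because the machine cannot multiply naturals. A counter \<open>r\<close> stands for the quantity
  \<open>r + 1\<close>, except in \<open>place_sample\<close>, where it stands for \<open>K - r\<close>.\<close>

abbreviation valuation_cell :: rexp where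
  "valuation_cell \<equiv> RRead ''v'' (NAdd (NRead ''o'' (nvar ''i'')) (nvar ''r''))"

abbreviation quantity :: nexp where
  "quantity \<equiv> NAdd (nvar ''r'') (NConst 1)"

text \<open>Both conjuncts are always evaluated. Truncated subtraction makes the divisor 0 when the
  quantity is not larger than the demand; the first conjunct discards that value.\<close>

definition breakpoint_test :: com where
  "breakpoint_test =
    (let x = RDiv (RSub valuation_cell (RRead ''c'' (nvar ''i'')))
               (RCast (NSub quantity (NRead ''q'' (nvar ''i''))))
     in If (BAnd (NLess (NRead ''q'' (nvar ''i'')) quantity) (RLess (rvar ''e'') x))
          (RWrite ''e'' (NConst 0) x) Skip)"

definition find_breakpoint :: com where
  "find_breakpoint = Seq (RWrite ''e'' (NConst 0) (RCast (NConst 0)))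
     (For ''i'' (nvar ''N'') (For ''r'' (nvar ''K'') breakpoint_test))"

definition crossing_test :: com where
  "crossing_test =
    (let i = NRead ''ord'' (nvar ''k''); j = NRead ''ord'' (NAdd (nvar ''k'') (NConst 1));
         x = RDiv (RSub (RRead ''c'' j) (RRead ''c'' i)) (RCast (NSub (NRead ''q'' j) (NRead ''q''
             i)))
     in If (BAnd (NLess (NRead ''q'' i) (NRead ''q'' j)) (RLess (rvar ''e'') x))
          (RWrite ''e'' (NConst 0) x) Skip)"

definition find_crossing :: com where
  "find_crossing = For ''k'' (NSub (nvar ''N'') (NConst 1)) crossing_test"

abbreviation height :: rexp where
  "height \<equiv> RSub (RRead ''c'' (nvar ''i'')) (RMul (RCast (NRead ''q'' (nvar ''i''))) (rvar ''e''))"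

definition demand_test :: com where
  "demand_test =
     If (RLess (RSub valuation_cell (RMul (RCast quantity) (rvar ''e''))) height) Skip
       (Seq (NWrite ''q'' (nvar ''i'') quantity) (RWrite ''c'' (nvar ''i'') valuation_cell))"

definition reset_demand :: com where
  "reset_demand =
     Seq (NWrite ''q'' (nvar ''i'') (NConst 0)) (RWrite ''c'' (nvar ''i'') (RCast (NConst 0)))"

definition update_demand :: com where
  "update_demand = For ''i'' (nvar ''N'')
     (Seq reset_demand (Seq (For ''r'' (nvar ''K'') demand_test) (RWrite ''h'' (nvar ''i'')
         height)))"

text \<open>At position 0 truncated subtraction compares the sample with itself, so the first block
  keeps the name 0.\<close>

definition mark_block :: com where
  "mark_block =
    Seq (If (RLess (RRead ''h'' (NRead ''ord'' (nvar ''k'')))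
               (RRead ''h'' (NRead ''ord'' (NSub (nvar ''k'') (NConst 1)))))
          (NWrite ''b'' (NConst 0) (nvar ''k'')) Skip)
    (Seq (NWrite ''block'' (NRead ''ord'' (nvar ''k'')) (nvar ''b''))
         (NWrite ''ptr'' (nvar ''k'') (nvar ''k'')))"

definition mark_blocks :: com where
  "mark_blocks =
     Seq (NWrite ''b'' (NConst 0) (NConst 0)) (For ''k'' (nvar ''N'') mark_block)"

definition place_sample :: com where
  "place_sample =
    (let x = NAdd (NRead ''q'' (nvar ''i'')) (nvar ''r''); b = NRead ''block'' (nvar ''i'')
     in If (BAnd (BNot (NLess x (nvar ''K''))) (BNot (NLess (nvar ''K'') x)))
         (Seq (NWrite ''ord'' (NRead ''ptr'' b) (nvar ''i''))
              (NWrite ''ptr'' b (NAdd (NRead ''ptr'' b) (NConst 1)))) Skip)"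

text \<open>Instead of storing buckets, all samples are scanned once per quantity, from
  \<open>K\<close> down to 0. This is of the same order as recomputing the demands.\<close>

definition sort_blocks :: com where
  "sort_blocks =
     For ''r'' (NAdd (nvar ''K'') (NConst 1)) (For ''i'' (nvar ''N'') place_sample)"

definition evaluate_prefix :: com where
  "evaluate_prefix =
    (let j = NRead ''ord'' (nvar ''k'');
         x = RAdd (RMul (RCast (NAdd (nvar ''k'') (NConst 1))) (RRead ''h'' j))
               (RMul (rvar ''e'') (RCast (nvar ''Q'')))
     in Seq (NWrite ''Q'' (NConst 0) (NAdd (nvar ''Q'') (NRead ''q'' j)))
          (If (RLess (rvar ''best'') x)
            (Seq (RWrite ''best'' (NConst 0) x)
            (Seq (RWrite ''p'' (NConst 0) (RRead ''h'' j)) (RWrite ''p'' (NConst 1) (rvar ''e''))))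
            Skip))"

definition evaluate :: com where
  "evaluate = Seq (NWrite ''Q'' (NConst 0) (NConst 0)) (For ''k'' (nvar ''N'') evaluate_prefix)"

definition sweep_step :: com where
  "sweep_step = Seq find_breakpoint (Seq find_crossing (Seq update_demand (Seq mark_blocks
     (Seq sort_blocks (Seq evaluate
       (If (RLess (RCast (NConst 0)) (rvar ''e'')) Skip (NWrite ''done'' (NConst 0) (NConst
           1))))))))"

text \<open>Zeroed memory already represents a price at which every demand is 0, the tariff (0, 0)
  and best revenue 0. Only the order and the row offsets are missing; \<open>a\<close> runs through
  the multiples of \<open>K\<close>.\<close>

definition initialise :: com where
  "initialise = For ''i'' (nvar ''N'')
     (Seq (NWrite ''ord'' (nvar ''i'') (nvar ''i''))
     (Seq (NWrite ''o'' (nvar ''i'') (nvar ''a''))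
          (NWrite ''a'' (NConst 0) (NAdd (nvar ''a'') (nvar ''K'')))))"

definition sweep :: com where
  "sweep = Seq initialise (While (NLess (nvar ''done'') (NConst 1)) sweep_step)"

section \<open>Correctness and running time\<close>

lemma is_max_insert: "is_max x A \<Longrightarrow> is_max (if x < y then y else x) (insert y A)"
  by (auto simp: is_max_def)

locale tariff_instance =
  fixes N K :: nat and v :: "nat \<Rightarrow> nat \<Rightarrow> real"
  assumes N_pos: "1 \<le> N" and K_pos: "1 \<le> K"
begin

lemma size_bounds: "1 \<le> N * K" "N \<le> N * K" "K \<le> N * K"
  using N_pos K_pos by (auto simp: Suc_le_eq)

text \<open>The 21 consists of 9 for entering and leaving the outer loop and 12 per round, both
  absorbed into \<open>N * K\<close>.\<close>

lemma nested_loop_time: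
  assumes "21 + a \<le> b"
  shows "ncost (nvar x) + 7 + N * (a * K + ncost (nvar x) + 10) \<le> b * (N * K)"
proof -
  have "ncost (nvar x) + 7 + N * (a * K + ncost (nvar x) + 10) = 9 + a * (N * K) + 12 * N"
    by (simp add: algebra_simps)
  also have "\<dots> \<le> (21 + a) * (N * K)"
    using size_bounds by (simp only: add_mult_distrib)
  also have "\<dots> \<le> b * (N * K)" using assms by (rule mult_le_mono1)
  finally show ?thesis .
qed

lemma single_loop_time:
  assumes "21 + a \<le> b"
  shows "ncost (nvar x) + 7 + N * (a + ncost (nvar x) + 10) \<le> b * (N * K)"
proof -
  have "N * (a + ncost (nvar x) + 10) \<le> N * (a * K + ncost (nvar x) + 10)"
    using K_pos by (intro mult_le_mono) auto
  then show ?thesis using nested_loop_time[OF assms, of x] by linarith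
qed

definition loaded :: "state \<Rightarrow> bool" where
  "loaded s \<longleftrightarrow> nats s ''N'' 0 = N \<and> nats s ''K'' 0 = K \<and>
     (\<forall>i<N. \<forall>r<K. reals s ''v'' (nats s ''o'' i + r) = v i (Suc r))"

lemma loaded_same_except:
  "loaded s \<Longrightarrow> same_except A B s s' \<Longrightarrow> ''N'' \<notin> A \<Longrightarrow> ''K'' \<notin> A \<Longrightarrow> ''o'' \<notin> A \<Longrightarrow> ''v'' \<notin> B \<Longrightarrow> loaded s'"
  by (simp add: loaded_def same_except_def)

section \<open>The phases of one sweep step\<close>

lemma runs_find_breakpoint:
  assumes s: "loaded s" and c: "\<And>i. i < N \<Longrightarrow> reals s ''c'' i = ext (v i) (nats s ''q'' i)"
  shows "runs find_breakpoint s (200 * (N * K)) (\<lambda>s'. same_except {''i'', ''r''} {''e''} s s' \<and>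
    is_max (reals s' ''e'' 0) (insert 0 (breakpoints N K v (nats s ''q''))))"
proof -
  let ?q = "nats s ''q''"
  let ?S = "same_except {''i'', ''r''} {''e''} s"
  let ?A = "\<lambda>i r. insert 0 {breakpoint (v i') (?q i') r' |i' r'. ?q i' < r' \<and> (i' < i \<and> r' \<le> K \<or>
      i' = i \<and> r' \<le> r)}"
  have ld: "nats s ''N'' 0 = N" "nats s ''K'' 0 = K"
      "\<And>i r. i < N \<Longrightarrow> r < K \<Longrightarrow> reals s ''v'' (nats s ''o'' i + r) = v i (Suc r)"
    using s by (auto simp: loaded_def)
  have A_step: "?A i (Suc r) =
      (if ?q i < Suc r then insert (breakpoint (v i) (?q i) (Suc r)) (?A i r) else ?A i r)" for i r
    by (auto simp: le_Suc_eq)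
  \<comment> \<open>The row of the next sample starts empty: no quantity exceeds its demand and is
    at most 0.\<close>
  have A_next: "?A i K = ?A (Suc i) 0" for i by (auto simp: less_Suc_eq)
  have A_last: "?A N 0 = insert 0 (breakpoints N K v ?q)" by (auto simp: breakpoints_def)
  have loop_i: "runs (For ''r'' (nvar ''K'') breakpoint_test) s1 (100 * K)
      (\<lambda>s'. ?S s' \<and> nats s' ''i'' 0 = i \<and> is_max (reals s' ''e'' 0) (?A i K))"
    if i: "i < N" and s1: "?S s1" "is_max (reals s1 ''e'' 0) (?A i 0)" "nats s1 ''i'' 0 = i"
        for i s1
  proof (rule runs_For[where n = K and T = 70 and
        I = "\<lambda>r s'. ?S s' \<and> nats s' ''i'' 0 = i \<and> is_max (reals s' ''e'' 0) (?A i r)"])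
    fix r s2 assume r: "r < K" and s2: "nats s2 ''r'' 0 = r"
      "?S s2 \<and> nats s2 ''i'' 0 = i \<and> is_max (reals s2 ''e'' 0) (?A i r)"
    have fr: "a \<notin> {''i'', ''r''} \<Longrightarrow> nats s2 a = nats s a" "a \<notin> {''e''} \<Longrightarrow>
        reals s2 a = reals s a" for a
      using s2 by (auto simp: same_except_def)
    have bp: "(v i (Suc r) - ext (v i) (?q i)) / real (Suc r - ?q i) =
        breakpoint (v i) (?q i) (Suc r)"
      if "?q i < Suc r"
      using that by (simp add: breakpoint_def ext_def of_nat_diff)
    have mx: "is_max (if ?q i < Suc r \<and> reals s2 ''e'' 0 < breakpoint (v i) (?q i) (Suc r)
        then breakpoint (v i) (?q i) (Suc r) else reals s2 ''e'' 0) (?A i (Suc r))"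
      unfolding A_step using s2 is_max_insert[of "reals s2 ''e'' 0" "?A i r"] by simp
    show "runs breakpoint_test s2 70 (\<lambda>s'. nats s' ''r'' 0 = r \<and> ?S (write_nat ''r'' 0 (Suc r) s') \<and>
        nats (write_nat ''r'' 0 (Suc r) s') ''i'' 0 = i \<and>
        is_max (reals (write_nat ''r'' 0 (Suc r) s') ''e'' 0) (?A i (Suc r)))"
      unfolding breakpoint_test_def Let_def
      using s2 mx bp by (cases "?q i < Suc r";
          cases "reals s2 ''e'' 0 < breakpoint (v i) (?q i) (Suc r)";
          intro runs_loop_free) (simp_all add: fr ld(3)[OF i r] c[OF i])
  qed (use s1 K_pos ld in \<open>auto simp: same_except_def\<close>)
  have loop: "runs (For ''i'' (nvar ''N'') (For ''r'' (nvar ''K'') breakpoint_test)) s1 (150 * (N *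
      K))
      (\<lambda>s'. ?S s' \<and> is_max (reals s' ''e'' 0) (?A N 0))"
    if s1: "?S s1" "is_max (reals s1 ''e'' 0) (?A 0 0)" for s1
  proof (rule runs_For[where n = N and T = "100 * K" and
        I = "\<lambda>i s'. ?S s' \<and> is_max (reals s' ''e'' 0) (?A i 0)", OF _ _ _ nested_loop_time])
    fix i s2 assume i: "i < N" and s2: "?S s2 \<and>
        is_max (reals s2 ''e'' 0) (?A i 0)" "nats s2 ''i'' 0 = i"
    show "runs (For ''r'' (nvar ''K'') breakpoint_test) s2 (100 * K)
        (\<lambda>s'. nats s' ''i'' 0 = i \<and> ?S (write_nat ''i'' 0 (Suc i) s') \<and>
           is_max (reals (write_nat ''i'' 0 (Suc i) s') ''e'' 0) (?A (Suc i) 0))"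
      unfolding A_next[symmetric] by (rule runs_mono[OF loop_i[OF i]]) (use s2 in auto)
  qed (use s1 ld in \<open>auto simp: same_except_def\<close>)
  show ?thesis unfolding find_breakpoint_def
  proof (rule runs_Seq[OF _ loop[unfolded A_last]])
    show "runs (RWrite ''e'' (NConst 0) (RCast (NConst 0))) s 4
        (\<lambda>s'. ?S s' \<and> is_max (reals s' ''e'' 0) (?A 0 0))"
      by (rule runs_loop_free) (auto simp: is_max_def)
    show "4 + 150 * (N * K) \<le> 200 * (N * K)" using size_bounds(1) by linarith
  qed auto
qed

lemma runs_find_crossing:
  assumes s: "loaded s" and c: "\<And>i. i < N \<Longrightarrow> reals s ''c'' i = ext (v i) (nats s ''q'' i)"
    and ord: "\<And>k. k < N \<Longrightarrow> nats s ''ord'' k < N"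
    and e: "is_max (reals s ''e'' 0) A"
  shows "runs find_crossing s (200 * (N * K)) (\<lambda>s'. same_except {''k''} {''e''} s s' \<and>
    is_max (reals s' ''e'' 0) (A \<union> crossings N v (nats s ''q'') (nats s ''ord'')))"
proof -
  let ?q = "nats s ''q''" and ?o = "nats s ''ord''"
  let ?S = "same_except {''k''} {''e''} s"
  let ?A = "\<lambda>k. A \<union> {crossing v ?q (?o l) (?o (Suc l)) |l. l < k \<and> ?q (?o l) < ?q (?o (Suc l))}"
  have A_step: "?A (Suc k) = (if ?q (?o k) < ?q (?o (Suc k))
      then insert (crossing v ?q (?o k) (?o (Suc k))) (?A k) else ?A k)" for k
    by (auto simp: less_Suc_eq)
  have "l < N - 1 \<longleftrightarrow> Suc l < N" for l by auto
  then have A_last: "?A (N - 1) = A \<union> crossings N v ?q ?o" by (simp add: crossings_def)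
  show ?thesis unfolding find_crossing_def A_last[symmetric]
  proof (rule runs_For[where n = "N - 1" and T = 70 and I = "\<lambda>k s'. ?S s' \<and>
      is_max (reals s' ''e'' 0) (?A k)"])
    fix k s2 assume k: "k < N - 1" and s2: "?S s2 \<and>
        is_max (reals s2 ''e'' 0) (?A k)" "nats s2 ''k'' 0 = k"
    let ?i = "?o k" and ?j = "?o (Suc k)"
    have fr: "a \<notin> {''k''} \<Longrightarrow> nats s2 a = nats s a" "a \<notin> {''e''} \<Longrightarrow> reals s2 a = reals s a" for a
      using s2 by (auto simp: same_except_def)
    have ij: "?i < N" "?j < N" using k ord by auto
    have cr: "(ext (v ?j) (?q ?j) - ext (v ?i) (?q ?i)) / real (?q ?j - ?q ?i) =
        crossing v ?q ?i ?j"
      if "?q ?i < ?q ?j"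
      using that by (simp add: crossing_def of_nat_diff)
    have mx: "is_max (if ?q ?i < ?q ?j \<and> reals s2 ''e'' 0 < crossing v ?q ?i ?j
        then crossing v ?q ?i ?j else reals s2 ''e'' 0) (?A (Suc k))"
      unfolding A_step using s2 is_max_insert[of "reals s2 ''e'' 0" "?A k"] by simp
    show "runs crossing_test s2 70 (\<lambda>s'. nats s' ''k'' 0 = k \<and> ?S (write_nat ''k'' 0 (Suc k) s') \<and>
        is_max (reals (write_nat ''k'' 0 (Suc k) s') ''e'' 0) (?A (Suc k)))"
      unfolding crossing_test_def Let_def
      using s2 mx cr by (cases "?q ?i < ?q ?j"; cases "reals s2 ''e'' 0 < crossing v ?q ?i ?j";
          intro runs_loop_free) (simp_all add: fr c ij)
  next
    show "ncost (NSub (nvar ''N'') (NConst 1)) + 7 + (N - 1) * (70 + ncost (NSub (nvar ''N'')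
        (NConst 1)) + 10) \<le> 200 * (N * K)"
    proof -
      define n where "n = N - 1"
      have "n \<le> N * K" unfolding n_def using size_bounds(2) by linarith
      moreover have 4: "ncost (NSub (nvar ''N'') (NConst 1)) = 4" by simp
      moreover have "n * (70 + 4 + 10) = 84 * n" by simp
      ultimately show ?thesis unfolding 4 n_def[symmetric] using size_bounds(1) by linarith
    qed
  qed (use s e in \<open>auto simp: same_except_def loaded_def\<close>)
qed

lemma runs_update_demand:
  assumes s: "loaded s"
  shows "runs update_demand s (200 * (N * K)) (\<lambda>s'. same_except {''i'', ''r'', ''q''} {''c'',
      ''h''} s s' \<and>
    (\<forall>i<N. nats s' ''q'' i = demand (v i) (reals s ''e'' 0) K \<and>
       reals s' ''c'' i = ext (v i) (nats s' ''q'' i) \<and>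
       reals s' ''h'' i = line (v i) (nats s' ''q'' i) (reals s ''e'' 0)))"
proof -
  define e where "e = reals s ''e'' 0"
  let ?S = "same_except {''i'', ''r'', ''q''} {''c'', ''h''} s"
  have ld: "nats s ''N'' 0 = N" "nats s ''K'' 0 = K"
      "\<And>i r. i < N \<Longrightarrow> r < K \<Longrightarrow> reals s ''v'' (nats s ''o'' i + r) = v i (Suc r)"
    using s by (auto simp: loaded_def)
  let ?C = "\<lambda>s' i r. nats s' ''q'' i = demand (v i) e r \<and>
      reals s' ''c'' i = ext (v i) (nats s' ''q'' i)"
  let ?D = "\<lambda>s' i. ?C s' i K \<and> reals s' ''h'' i = line (v i) (nats s' ''q'' i) e"
  let ?J = "\<lambda>i s'. ?S s' \<and> nats s' ''i'' 0 = i \<and> (\<forall>j<i. ?D s' j)"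
  have loop_i: "runs (For ''r'' (nvar ''K'') demand_test) s1 (100 * K) (\<lambda>s'. ?J i s' \<and> ?C s' i K)"
    if i: "i < N" and s1: "?J i s1 \<and> ?C s1 i 0" for i s1
  proof (rule runs_For[where n = K and T = 70 and I = "\<lambda>r s'. ?J i s' \<and> ?C s' i r"])
    fix r s2 assume r: "r < K" and s2: "?J i s2 \<and> ?C s2 i r" "nats s2 ''r'' 0 = r"
    have fr: "a \<notin> {''i'', ''r'', ''q''} \<Longrightarrow> nats s2 a = nats s a" "a \<notin> {''c'', ''h''} \<Longrightarrow>
        reals s2 a = reals s a" for a
      using s2 by (auto simp: same_except_def)
    have ln: "line (v i) (Suc r) e = v i (Suc r) - real (Suc r) * e"
      "line (v i) (demand (v i) e r) e = ext (v i) (demand (v i) e r) - real (demand (v i) e r) * e"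
      by (simp_all add: line_def ext_def)
    have ee: "reals s2 ''e'' 0 = e" using fr by (simp add: e_def)
    have vv: "reals s2 ''v'' (nats s2 ''o'' i + r) = v i (Suc r)" using fr ld(3)[OF i r] by simp
    show "runs demand_test s2 70 (\<lambda>s'. nats s' ''r'' 0 = r \<and>
        ?J i (write_nat ''r'' 0 (Suc r) s') \<and> ?C (write_nat ''r'' 0 (Suc r) s') i (Suc r))"
      unfolding demand_test_def
    proof (rule runs_loop_free)
      show "max_time (If (RLess (RSub valuation_cell (RMul (RCast quantity) (rvar ''e''))) height)
          Skip
       (Seq (NWrite ''q'' (nvar ''i'') quantity) (RWrite ''c'' (nvar ''i'') valuation_cell))) \<le> 70"
           by simp
    qed (use s2 ee vv ln in \<open>auto simp: ext_def\<close>)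
  qed (use s1 K_pos ld in \<open>auto simp: same_except_def\<close>)
  have body: "runs (Seq reset_demand (Seq (For ''r'' (nvar ''K'') demand_test) (RWrite ''h'' (nvar
      ''i'') height))) s1
      (150 * K) (\<lambda>s'. nats s' ''i'' 0 = i \<and> ?S s' \<and> (\<forall>j<Suc i. ?D s' j))"
    if i: "i < N" and s1: "?J i s1" for i s1
  proof (rule runs_Seq)
    show "runs reset_demand s1 20 (\<lambda>s'. ?J i s' \<and> ?C s' i 0)"
      unfolding reset_demand_def using s1 by (intro runs_loop_free) (auto simp: ext_def)
    show "20 + 120 * K \<le> 150 * K" using K_pos by simp
    fix s2 assume s2: "?J i s2 \<and> ?C s2 i 0"
    show "runs (Seq (For ''r'' (nvar ''K'') demand_test) (RWrite ''h'' (nvar ''i'') height)) s2 (120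
        * K)
      (\<lambda>s'. nats s' ''i'' 0 = i \<and> ?S s' \<and> (\<forall>j<Suc i. ?D s' j))"
    proof (rule runs_Seq[OF loop_i[OF i s2]])
      show "100 * K + 20 \<le> 120 * K" using K_pos by simp
      fix s3 assume s3: "?J i s3 \<and> ?C s3 i K"
      have "reals s3 ''e'' 0 = e" using s3 by (simp add: same_except_def e_def)
      then show "runs (RWrite ''h'' (nvar ''i'') height) s3 20 (\<lambda>s'. nats s' ''i'' 0 = i \<and> ?S s' \<and>
          (\<forall>j<Suc i. ?D s' j))"
        using s3 by (intro runs_loop_free) (auto simp: line_def less_Suc_eq)
    qed
  qed
  have "runs update_demand s (200 * (N * K)) (\<lambda>s'. ?S s' \<and> (\<forall>j<N. ?D s' j))"
    unfolding update_demand_def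
  proof (rule runs_For[where n = N and T = "150 * K" and I = "\<lambda>i s'. ?S s' \<and>
      (\<forall>j<i. ?D s' j)", OF _ _ _ nested_loop_time])
    fix i s2 assume i: "i < N" and s2: "?S s2 \<and> (\<forall>j<i. ?D s2 j)" "nats s2 ''i'' 0 = i"
    show "runs (Seq reset_demand (Seq (For ''r'' (nvar ''K'') demand_test) (RWrite ''h'' (nvar
        ''i'') height))) s2
      (150 * K) (\<lambda>s'. nats s' ''i'' 0 = i \<and> ?S (write_nat ''i'' 0 (Suc i) s') \<and>
          (\<forall>j<Suc i. ?D (write_nat ''i'' 0 (Suc i) s') j))"
      by (rule runs_mono[OF body[OF i]]) (use s2 in auto)
  qed (use ld in \<open>auto simp: same_except_def\<close>)
  then show ?thesis by (rule runs_mono) (auto simp: e_def)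
qed

lemma runs_mark_blocks:
  assumes s: "loaded s" and bij: "bij_betw (nats s ''ord'') {..<N} {..<N}"
    and desc: "\<And>k l. k < l \<Longrightarrow> l < N \<Longrightarrow>
        reals s ''h'' (nats s ''ord'' l) \<le> reals s ''h'' (nats s ''ord'' k)"
  shows "runs mark_blocks s (200 * (N * K)) (\<lambda>s'. same_except {''k'', ''b'', ''block'',
      ''ptr''} {} s s' \<and>
    (\<forall>k<N. nats s' ''ptr'' k = k) \<and> (\<forall>j<N. nats s' ''block'' j = num_above N (reals s ''h'') j))"
proof -
  let ?o = "nats s ''ord''" and ?h = "reals s ''h''"
  let ?S = "same_except {''k'', ''b'', ''block'', ''ptr''} {} s"
  \<comment> \<open>\<open>b\<close> names the block of the preceding position. For
    \<open>k = 0\<close> truncation makes this position 0, whose block has the name 0.\<close>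
  let ?I = "\<lambda>k s'. ?S s' \<and> nats s' ''b'' 0 = num_above N ?h (?o (k - 1)) \<and>
      (\<forall>l<k. nats s' ''ptr'' l = l) \<and>
     (\<forall>l<k. nats s' ''block'' (?o l) = num_above N ?h (?o l))"
  have inj: "?o k = ?o l \<longleftrightarrow> k = l" if "k < N" "l < N" for k l
    using bij that by (auto simp: bij_betw_def inj_on_def)
  have next_above: "num_above N ?h (?o k) =
      (if ?h (?o k) < ?h (?o (k - 1)) then k else num_above N ?h (?o (k - 1)))"
    if k: "k < N" for k
  proof (cases "?h (?o k) < ?h (?o (k - 1))")
    case True
    have "?h (?o k) < ?h (?o l)" if "l < k" for l
    proof -
      have "l = k - 1 \<or> l < k - 1" using that by linarith
      moreover have "k - 1 < N" using k by linarith
      ultimately show ?thesis using desc[of l "k - 1"] True by force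
    qed
    then show ?thesis using num_above_first[where h = ?h, OF bij desc k] True by simp
  next
    case False
    have "?h (?o k) = ?h (?o (k - 1))" using False desc[of "k - 1" k] k by (cases "k = 0") auto
    then show ?thesis by (simp add: num_above_def)
  qed
  have first: "num_above N ?h (?o 0) = 0" using num_above_first[where h = ?h
      and k = 0, OF bij desc] N_pos by simp
  have "runs mark_blocks s (200 * (N * K)) (?I N)" unfolding mark_blocks_def
  proof (rule runs_Seq)
    show "runs (NWrite ''b'' (NConst 0) (NConst 0)) s 3 (?I 0)"
      using first by (intro runs_loop_free) simp_all
    show "3 + 150 * (N * K) \<le> 200 * (N * K)" using size_bounds(1) by linarith
    fix s1 assume s1: "?I 0 s1"
    show "runs (For ''k'' (nvar ''N'') mark_block) s1 (150 * (N * K)) (?I N)"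
    proof (rule runs_For[where n = N and T = 70 and I = ?I, OF _ _ _ single_loop_time])
      fix k s2 assume k: "k < N" and s2: "?I k s2" "nats s2 ''k'' 0 = k"
      have fr: "a \<notin> {''k'', ''b'', ''block'', ''ptr''} \<Longrightarrow>
          nats s2 a = nats s a" "reals s2 a = reals s a" for a
        using s2 by (auto simp: same_except_def)
      have "?o l \<noteq> ?o k" if "l < k" for l using inj[of l k] k that by simp
      then show "runs mark_block s2 70 (\<lambda>s'. nats s' ''k'' 0 = k \<and>
          ?I (Suc k) (write_nat ''k'' 0 (Suc k) s'))"
        unfolding mark_block_def
        using s2 next_above[OF k] by (intro runs_loop_free) (simp_all add: fr less_Suc_eq)
    qed (use s1 s in \<open>auto simp: same_except_def loaded_def\<close>)
  qed
  then show ?thesis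
  proof (rule runs_mono)
    fix s' assume s': "?I N s'"
    have "nats s' ''block'' j = num_above N ?h j" if "j < N" for j
    proof -
      obtain l where "l < N" "j = ?o l" using bij \<open>j < N\<close> by (auto simp: bij_betw_def)
      then show ?thesis using s' by simp
    qed
    then show "?S s' \<and> (\<forall>k<N. nats s' ''ptr'' k = k) \<and>
        (\<forall>j<N. nats s' ''block'' j = num_above N ?h j)"
      using s' by blast
  qed simp
qed

lemma runs_sort_blocks:
  assumes s: "loaded s" and ptr: "\<And>k. k < N \<Longrightarrow> nats s ''ptr'' k = k"
    and block: "\<And>j. j < N \<Longrightarrow> nats s ''block'' j = num_above N h j"
    and q: "\<And>j. j < N \<Longrightarrow> nats s ''q'' j \<le> K"
  shows "runs sort_blocks s (500 * (N * K)) (\<lambda>s'. same_except {''r'', ''i'', ''ord'',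
      ''ptr''} {} s s' \<and>
    (\<forall>j<N. nats s' ''ord'' (rank N h (nats s ''q'') j) = j))"
proof -
  let ?q = "nats s ''q''"
  let ?S = "same_except {''r'', ''i'', ''ord'', ''ptr''} {} s"
  \<comment> \<open>The samples placed before round \<open>i\<close> of pass \<open>r\<close>: all
    quantities above \<open>K - r\<close>, and those equal to it with a smaller index.\<close>
  let ?D = "\<lambda>r i. {j. j < N \<and> (K < ?q j + r \<or> ?q j + r = K \<and> j < i)}"
  let ?I = "\<lambda>r i s'. ?S s' \<and> bucketed N h ?q (?D r i) (nats s' ''ptr'') (nats s' ''ord'')"
  have ld: "nats s ''N'' 0 = N" "nats s ''K'' 0 = K" using s by (auto simp: loaded_def)
  have D_next: "?D r N = ?D (Suc r) 0" for r by auto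
  have D_first: "?D 0 0 = {}" using q by fastforce
  have D_last: "?D (Suc K) 0 = {..<N}" by auto
  have "num_above N h j < N" if "j < N" for j
  proof -
    have "{i. i < N \<and> h j < h i} \<subset> {..<N}" using that by auto
    then have "card {i. i < N \<and> h j < h i} < card {..<N}" by (intro psubset_card_mono) simp_all
    then show ?thesis by (simp add: num_above_def)
  qed
  then have init: "?I 0 0 s" unfolding D_first using ptr by (simp add: bucketed_def)
  have loop_r: "runs (For ''i'' (nvar ''N'') place_sample) s1 (100 * N) (\<lambda>s'. ?I r N s' \<and>
      nats s' ''r'' 0 = r)"
    if s1: "?I r 0 s1" "nats s1 ''r'' 0 = r" for r s1
  proof (rule runs_For[where n = N and T = 70 and I = "\<lambda>i s'. ?I r i s' \<and> nats s' ''r'' 0 = r"])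
    fix i s2 assume i: "i < N" and s2: "?I r i s2 \<and> nats s2 ''r'' 0 = r" "nats s2 ''i'' 0 = i"
    have fr: "a \<notin> {''r'', ''i'', ''ord'', ''ptr''} \<Longrightarrow>
        nats s2 a = nats s a" "reals s2 a = reals s a" for a
      using s2 by (auto simp: same_except_def)
    let ?b = "num_above N h i"
    have step: "bucketed N h ?q (?D r (Suc i)) ((nats s2 ''ptr'')(?b := Suc (nats s2 ''ptr'' ?b)))
        ((nats s2 ''ord'')(nats s2 ''ptr'' ?b := i))" if qi: "?q i + r = K"
    proof -
      have "?D r (Suc i) = insert i (?D r i)" using qi i by (auto simp: less_Suc_eq)
      moreover have "bucketed N h ?q (insert i (?D r i)) ((nats s2 ''ptr'')(?b := Suc (nats s2
          ''ptr'' ?b)))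
          ((nats s2 ''ord'')(nats s2 ''ptr'' ?b := i))"
        using s2 i qi by (intro bucketed_insert) auto
      ultimately show ?thesis by simp
    qed
    have skip: "?D r (Suc i) = ?D r i" if "?q i + r \<noteq> K" using that by (auto simp: less_Suc_eq)
    show "runs place_sample s2 70 (\<lambda>s'. nats s' ''i'' 0 = i \<and>
        ?I r (Suc i) (write_nat ''i'' 0 (Suc i) s') \<and>
        nats (write_nat ''i'' 0 (Suc i) s') ''r'' 0 = r)"
    proof (cases "?q i + r = K")
      case True
      then show ?thesis unfolding place_sample_def Let_def
        using s2 step by (intro runs_loop_free) (simp_all add: fr ld block[OF i])
    next
      case False
      then have "?q i + r < K \<or> K < ?q i + r" by linarith
      then show ?thesis unfolding place_sample_def Let_def skip[OF False]
        using s2 by (elim disjE; intro runs_loop_free) (simp_all add: fr ld block[OF i])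
    qed
  qed (use s1 ld N_pos in \<open>auto simp: same_except_def\<close>)
  have "runs sort_blocks s (500 * (N * K)) (?I (Suc K) 0)" unfolding sort_blocks_def
  proof (rule runs_For[where n = "Suc K" and T = "100 * N" and I = "\<lambda>r s'. ?I r 0 s'"])
    fix r s1 assume s1: "?I r 0 s1" "nats s1 ''r'' 0 = r"
    show "runs (For ''i'' (nvar ''N'') place_sample) s1 (100 * N)
        (\<lambda>s'. nats s' ''r'' 0 = r \<and> ?I (Suc r) 0 (write_nat ''r'' 0 (Suc r) s'))"
      unfolding D_next[symmetric] by (rule runs_mono[OF loop_r[OF s1]]) auto
  next
    show "ncost (NAdd (nvar ''K'') (NConst 1)) + 7 + Suc K * (100 * N + ncost (NAdd (nvar ''K'')
        (NConst 1)) + 10) \<le> 500 * (N * K)"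
    proof -
      have 4: "ncost (NAdd (nvar ''K'') (NConst 1)) = 4" by simp
      have "Suc K * (100 * N + 4 + 10) = 100 * (N * K) + 100 * N + 14 * K + 14"
          by (simp add: algebra_simps)
      then show ?thesis unfolding 4 using size_bounds by linarith
    qed
  qed (use init ld in \<open>auto simp: same_except_def\<close>)
  then show ?thesis unfolding D_last by (rule runs_mono) (auto simp: bucketed_def)
qed

lemma runs_evaluate:
  assumes s: "loaded s"
    and h: "\<And>i. i < N \<Longrightarrow> reals s ''h'' i = line (v i) (nats s ''q'' i) (reals s ''e'' 0)"
    and ord: "\<And>k. k < N \<Longrightarrow> nats s ''ord'' k < N"
  shows "runs evaluate s (200 * (N * K)) (\<lambda>s'. same_except {''k'', ''Q''} {''best'', ''p''} s s' \<and>
    reals s ''best'' 0 \<le> reals s' ''best'' 0 \<and>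
    (\<forall>k<N. prefix_revenue v (nats s ''q'') (nats s ''ord'') k (reals s ''e'' 0) \<le>
        reals s' ''best'' 0) \<and>
    (reals s' ''best'' 0 = reals s ''best'' 0 \<and> output_tariff s' = output_tariff s \<or>
     (\<exists>k<N. reals s' ''best'' 0 =
         prefix_revenue v (nats s ''q'') (nats s ''ord'') k (reals s ''e'' 0) \<and>
        output_tariff s' = (reals s ''h'' (nats s ''ord'' k), reals s ''e'' 0))))"
proof -
  let ?q = "nats s ''q''" and ?o = "nats s ''ord''" and ?e = "reals s ''e'' 0"
  let ?S = "same_except {''k'', ''Q''} {''best'', ''p''} s"
  let ?P = "\<lambda>k. prefix_revenue v ?q ?o k ?e"
  let ?I = "\<lambda>k s'. ?S s' \<and> nats s' ''Q'' 0 = (\<Sum>j<k. ?q (?o j)) \<and>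
    reals s ''best'' 0 \<le> reals s' ''best'' 0 \<and> (\<forall>l<k. ?P l \<le> reals s' ''best'' 0) \<and>
    (reals s' ''best'' 0 = reals s ''best'' 0 \<and> output_tariff s' = output_tariff s \<or>
     (\<exists>l<k. reals s' ''best'' 0 = ?P l \<and> output_tariff s' = (reals s ''h'' (?o l), ?e)))"
  have "runs evaluate s (200 * (N * K)) (?I N)" unfolding evaluate_def
  proof (rule runs_Seq)
    show "runs (NWrite ''Q'' (NConst 0) (NConst 0)) s 3 (?I 0)"
      by (rule runs_loop_free) (simp_all add: output_tariff_def)
    show "3 + 150 * (N * K) \<le> 200 * (N * K)" using size_bounds(1) by linarith
    fix s1 assume s1: "?I 0 s1"
    show "runs (For ''k'' (nvar ''N'') evaluate_prefix) s1 (150 * (N * K)) (?I N)"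
    proof (rule runs_For[where n = N and T = 100 and I = ?I, OF _ _ _ single_loop_time])
      fix k s2 assume k: "k < N" and s2: "?I k s2" "nats s2 ''k'' 0 = k"
      have fr: "a \<notin> {''k'', ''Q''} \<Longrightarrow> nats s2 a = nats s a" "a \<notin> {''best'', ''p''} \<Longrightarrow>
          reals s2 a = reals s a" for a
        using s2 by (auto simp: same_except_def)
      have Q: "(\<Sum>j<k. ?q (?o j)) + ?q (?o k) = (\<Sum>j<Suc k. ?q (?o j))" by simp
      have P: "real (Suc k) * reals s ''h'' (?o k) + ?e * real (\<Sum>j<Suc k. ?q (?o j)) = ?P k"
        using h[OF ord[OF k]] by (simp add: prefix_revenue_def lessThan_Suc_atMost del:
            sum.lessThan_Suc)
      define x where "x = ?P k"
      have run: "run evaluate_prefix s2 = (let s' = write_nat ''Q'' 0 (\<Sum>j<Suc k. ?q (?o j)) s2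
          in if reals s2 ''best'' 0 < x
            then write_real ''p'' 1 ?e (write_real ''p'' 0 (reals s ''h'' (?o k)) (write_real
                ''best'' 0 x s')) else s')"
        unfolding evaluate_prefix_def Let_def x_def P[symmetric] Q[symmetric] using s2
            by (simp add: fr)
      have "?I (Suc k) (write_nat ''k'' 0 (Suc k) (run evaluate_prefix s2))"
      proof (cases "reals s2 ''best'' 0 < x")
        case True
        have "?P l \<le> x" if "l < Suc k" for l
        proof (cases "l = k")
          case False
          then have "l < k" using that by simp
          then have "?P l \<le> reals s2 ''best'' 0" using s2(1) by simp
          then show ?thesis using True by linarith
        qed (simp add: x_def)
        moreover have "reals s ''best'' 0 \<le> x" using s2(1) True by linarith
        ultimately show ?thesis unfolding run Let_def using s2 True
          by (auto simp: output_tariff_def x_def simp del: sum.lessThan_Suc)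
      next
        case False
        then show ?thesis unfolding run Let_def using s2
          by (auto simp: output_tariff_def x_def less_Suc_eq simp del: sum.lessThan_Suc)
      qed
      moreover have "nats (run evaluate_prefix s2) ''k'' 0 = k" using s2 unfolding run Let_def
          by simp
      ultimately show "runs evaluate_prefix s2 100 (\<lambda>s'. nats s' ''k'' 0 = k \<and>
          ?I (Suc k) (write_nat ''k'' 0 (Suc k) s'))"
        by (intro runs_loop_free) (simp_all add: evaluate_prefix_def Let_def)
    qed (use s1 s in \<open>auto simp: same_except_def loaded_def output_tariff_def\<close>)
  qed
  then show ?thesis by (rule runs_mono) auto
qed


text \<open>\<open>e\<close> is a parameter and not read from memory because the initial price is
  never computed. \<open>best\<close> lies between all revenues at prices from \<open>e\<close> on
  and the revenue of the stored tariff, so at \<open>e = 0\<close> that tariff is optimal.\<close>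

definition invariant :: "real \<Rightarrow> state \<Rightarrow> bool" where
  "invariant e s \<longleftrightarrow> loaded s \<and> swept N K v e (nats s ''q'') (nats s ''ord'') \<and>
     (\<forall>i<N. reals s ''c'' i = ext (v i) (nats s ''q'' i)) \<and>
     output_tariff s \<in> tariffs \<and> 0 \<le> reals s ''best'' 0 \<and>
     reals s ''best'' 0 \<le> total_revenue N K v (output_tariff s) \<and>
     (\<forall>\<rho>\<in>tariffs. e \<le> snd \<rho> \<longrightarrow> total_revenue N K v \<rho> \<le> reals s ''best'' 0)"

lemma runs_sweep_step:
  assumes inv: "invariant e s" and "0 < e" and "nats s ''done'' 0 = 0"
  shows "runs sweep_step s (2000 * (N * K)) (\<lambda>s'. \<exists>e'. 0 \<le> e' \<and> e' < e \<and> (0 < e' \<longrightarrow>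
      piece_end N K v e') \<and>
    invariant e' s' \<and> nats s' ''done'' 0 = (if 0 < e' then 0 else 1))"
proof -
  let ?q = "nats s ''q''" and ?o = "nats s ''ord''"
  have ld: "loaded s" and sw: "swept N K v e ?q ?o"
    and c: "\<And>i. i < N \<Longrightarrow> reals s ''c'' i = ext (v i) (?q i)" using inv by (auto simp: invariant_def)
  have bij: "bij_betw ?o {..<N} {..<N}" using sw by (simp add: swept_def height_order_def)
  have o_less: "?o k < N" if "k < N" for k using bij that by (auto simp: bij_betw_def)
  let ?P1 = "\<lambda>s'. same_except {''i'', ''r''} {''e''} s s' \<and>
    is_max (reals s' ''e'' 0) (insert 0 (breakpoints N K v ?q))"
  let ?P2 = "\<lambda>s'. same_except {''i'', ''r'', ''k''} {''e''} s s' \<and>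
      is_max (reals s' ''e'' 0) (events N K v ?q ?o)"
  let ?W3 = "{''i'', ''r'', ''k'', ''q''}"
  let ?H = "\<lambda>s'. is_max (reals s' ''e'' 0) (events N K v ?q ?o) \<and>
      (\<forall>i<N. nats s' ''q'' i = demand (v i) (reals s' ''e'' 0) K \<and>
       reals s' ''c'' i = ext (v i) (nats s' ''q'' i) \<and>
       reals s' ''h'' i = line (v i) (nats s' ''q'' i) (reals s' ''e'' 0))"
  let ?P3 = "\<lambda>s'. same_except ?W3 {''e'', ''c'', ''h''} s s' \<and> ?H s'"
  let ?P4 = "\<lambda>s'. same_except (?W3 \<union> {''b'', ''block'', ''ptr''}) {''e'', ''c'', ''h''} s s' \<and>
      ?H s' \<and>
    (\<forall>k<N. nats s' ''ptr'' k = k) \<and> (\<forall>j<N. nats s' ''block'' j = num_above N (reals s' ''h'') j)"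
  let ?W5 = "?W3 \<union> {''b'', ''block'', ''ptr'', ''ord''}"
  let ?P5 = "\<lambda>s'. same_except ?W5 {''e'', ''c'', ''h''} s s' \<and> ?H s' \<and>
    (\<forall>j<N. nats s' ''ord'' (rank N (reals s' ''h'') (nats s' ''q'') j) = j)"
  let ?P6 = "\<lambda>s'. 0 \<le> reals s' ''e'' 0 \<and> reals s' ''e'' 0 < e \<and>
    (0 < reals s' ''e'' 0 \<longrightarrow> piece_end N K v (reals s' ''e'' 0)) \<and> invariant (reals s' ''e'' 0) s' \<and>
        nats s' ''done'' 0 = 0"
  have r1: "runs find_breakpoint s (200 * (N * K)) ?P1"
    by (rule runs_find_breakpoint[OF ld c])
  have r2: "runs find_crossing s1 (200 * (N * K)) ?P2" if s1: "?P1 s1" for s1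
  proof -
    have fr: "same_except {''i'', ''r''} {''e''} s s1" using s1 by blast
    have eq: "nats s1 ''q'' = ?q" "nats s1 ''ord'' = ?o" "reals s1 ''c'' = reals s ''c''"
      using fr by (simp_all add: same_except_def)
    have "loaded s1" using loaded_same_except[OF ld fr] by simp
    from runs_find_crossing[OF this, unfolded eq, OF c o_less] s1
    have "runs find_crossing s1 (200 * (N * K)) (\<lambda>s'. same_except {''k''} {''e''} s1 s' \<and>
       is_max (reals s' ''e'' 0) (insert 0 (breakpoints N K v ?q) \<union> crossings N v ?q ?o))" by blast
    then show ?thesis
      by (rule runs_mono) (auto simp: events_def intro: same_except_trans[OF fr])
  qed
  have r3: "runs update_demand s2 (200 * (N * K)) ?P3" if s2: "?P2 s2" for s2
  proof -
    have fr: "same_except {''i'', ''r'', ''k''} {''e''} s s2" using s2 by blast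
    have "loaded s2" using loaded_same_except[OF ld fr] by simp
    from runs_update_demand[OF this] show ?thesis
    proof (rule runs_mono)
      fix s' assume s': "same_except {''i'', ''r'', ''q''} {''c'', ''h''} s2 s' \<and>
        (\<forall>i<N. nats s' ''q'' i = demand (v i) (reals s2 ''e'' 0) K \<and>
         reals s' ''c'' i = ext (v i) (nats s' ''q'' i) \<and>
         reals s' ''h'' i = line (v i) (nats s' ''q'' i) (reals s2 ''e'' 0))"
      then have fr': "same_except {''i'', ''r'', ''q''} {''c'', ''h''} s2 s'" by blast
      then have "reals s' ''e'' = reals s2 ''e''" by (simp add: same_except_def)
      then show "?P3 s'" using s' s2 same_except_trans[OF fr fr', of ?W3 "{''e'', ''c'', ''h''}"]
          by simp
    qed simp
  qed
  have r4: "runs mark_blocks s3 (200 * (N * K)) ?P4" if s3: "?P3 s3" for s3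
  proof -
    have fr: "same_except ?W3 {''e'', ''c'', ''h''} s s3" using s3 by blast
    have ld3: "loaded s3" using loaded_same_except[OF ld fr] by simp
    have o3: "nats s3 ''ord'' = ?o" using fr by (simp add: same_except_def)
    let ?e = "reals s3 ''e'' 0"
    have mx: "is_max ?e (events N K v ?q ?o)" using s3 by blast
    have "?e < e" using next_event_less[OF sw mx \<open>0 < e\<close>] .
    then have le: "?e \<le> e" by simp
    have po: "height_order N v ?e ?q ?o"
      by (rule height_order_below[OF sw le]) (use mx in \<open>auto simp: is_max_def events_def\<close>)
    \<comment> \<open>The heights were computed from the new demand, but at the event the old
      quantity is still a maximizer. Hence the old order is sorted by the new heights, as marking
      the blocks requires.\<close>
    have h3: "reals s3 ''h'' i = line (v i) (?q i) ?e" if i: "i < N" for i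
    proof -
      have "reals s3 ''h'' i = surplus K (v i) ?e" using s3 i by (simp add: surplus_def)
      moreover have "line (v i) r ?e \<le> line (v i) (?q i) ?e" if "r \<le> K" for r
        by (rule line_le_below[OF sw le i that]) (use mx i
            in \<open>auto simp: is_max_def events_def breakpoints_def\<close>)
      then have "surplus K (v i) ?e \<le> line (v i) (?q i) ?e" using demand_le
          by (simp add: surplus_def)
      moreover have "line (v i) (?q i) ?e \<le> surplus K (v i) ?e"
        using sw i demand_le by (intro line_le_surplus) (simp add: swept_def)
      ultimately show ?thesis by simp
    qed
    have "runs mark_blocks s3 (200 * (N * K)) (\<lambda>s'. same_except {''k'', ''b'', ''block'',
        ''ptr''} {} s3 s' \<and>
      (\<forall>k<N. nats s' ''ptr'' k = k) \<and> (\<forall>j<N. nats s' ''block'' j = num_above N (reals s3 ''h'') j))"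
      using po h3 o_less by (intro runs_mark_blocks[OF ld3]) (auto simp: o3 bij height_order_def)
    then show ?thesis
    proof (rule runs_mono)
      fix s' assume s': "same_except {''k'', ''b'', ''block'', ''ptr''} {} s3 s' \<and>
        (\<forall>k<N. nats s' ''ptr'' k = k) \<and>
            (\<forall>j<N. nats s' ''block'' j = num_above N (reals s3 ''h'') j)"
      then have fr': "same_except {''k'', ''b'', ''block'', ''ptr''} {} s3 s'" by blast
      then have "reals s' = reals s3" "nats s' ''q'' = nats s3 ''q''"
          by (auto simp: same_except_def)
      then show "?P4 s'" using s' s3
          same_except_trans[OF fr fr', of "?W3 \<union>
              {''b'', ''block'', ''ptr''}" "{''e'', ''c'', ''h''}"] by simp
    qed simp
  qed
  have r5: "runs sort_blocks s4 (500 * (N * K)) ?P5" if s4: "?P4 s4" for s4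
  proof -
    have fr: "same_except (?W3 \<union> {''b'', ''block'', ''ptr''}) {''e'', ''c'', ''h''} s s4" using s4
        by blast
    have ld4: "loaded s4" using loaded_same_except[OF ld fr] by simp
    have "runs sort_blocks s4 (500 * (N * K)) (\<lambda>s'. same_except {''r'', ''i'', ''ord'',
        ''ptr''} {} s4 s' \<and>
      (\<forall>j<N. nats s' ''ord'' (rank N (reals s4 ''h'') (nats s4 ''q'') j) = j))"
      using s4 demand_le by (intro runs_sort_blocks[OF ld4]) simp_all
    then show ?thesis
    proof (rule runs_mono)
      fix s' assume s': "same_except {''r'', ''i'', ''ord'', ''ptr''} {} s4 s' \<and>
        (\<forall>j<N. nats s' ''ord'' (rank N (reals s4 ''h'') (nats s4 ''q'') j) = j)"
      then have fr': "same_except {''r'', ''i'', ''ord'', ''ptr''} {} s4 s'" by blast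
      then have "reals s' = reals s4" "nats s' ''q'' = nats s4 ''q''"
          by (auto simp: same_except_def)
      then show "?P5 s'" using s' s4
          same_except_trans[OF fr fr', of ?W5 "{''e'', ''c'', ''h''}"] by simp
    qed simp
  qed
  have r6: "runs evaluate s5 (200 * (N * K)) ?P6" if s5: "?P5 s5" for s5
  proof -
    have fr: "same_except ?W5 {''e'', ''c'', ''h''} s s5" using s5 by blast
    have ld5: "loaded s5" using loaded_same_except[OF ld fr] by simp
    let ?e = "reals s5 ''e'' 0" and ?q5 = "nats s5 ''q''" and ?o5 = "nats s5 ''ord''"
    have mx: "is_max ?e (events N K v ?q ?o)" using s5 by blast
    have e_less: "?e < e" using next_event_less[OF sw mx \<open>0 < e\<close>] .
    have e_nonneg: "0 \<le> ?e" using mx by (auto simp: is_max_def events_def)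
    have q5: "?q5 i = demand (v i) ?e K" and c5: "reals s5 ''c'' i = ext (v i) (?q5 i)"
      and h5: "reals s5 ''h'' i = line (v i) (?q5 i) ?e" if "i < N" for i
      using s5 that by blast+
    note sorted = sorted_by_rank[of N ?o5 "reals s5 ''h''" ?q5]
    have bij5: "bij_betw ?o5 {..<N} {..<N}" using s5 by (intro sorted(1)) blast
    have prec: "precedes (reals s5 ''h'') ?q5 (?o5 k) (?o5 l)" if "k < l" "l < N" for k l
      using s5 that by (intro sorted(2)) blast+
    have o5: "?o5 k < N" if "k < N" for k using bij5 that by (auto simp: bij_betw_def)
    have h5o: "reals s5 ''h'' (?o5 k) = line (v (?o5 k)) (?q5 (?o5 k)) ?e" if "k < N" for k
      using h5[OF o5[OF that]] .
    have po5: "height_order N v ?e ?q5 ?o5"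
      using bij5 prec by (force simp: height_order_def precedes_def h5o)
    have sw5: "swept N K v ?e ?q5 ?o5"
      using po5 q5 prec by (force simp: swept_def precedes_def h5o)
    have sur: "surplus K (v i) ?e = line (v i) (?q5 i) ?e" if "i < N" for i
      using q5[OF that] by (simp add: surplus_def)
    have old: "reals s5 ''best'' = reals s ''best''" "output_tariff s5 =
        output_tariff s" "nats s5 ''done'' = nats s ''done''"
      using fr by (simp_all add: same_except_def output_tariff_def)
    from runs_evaluate[OF ld5 h5 o5] show ?thesis
    proof (rule runs_mono)
      fix s' assume s': "same_except {''k'', ''Q''} {''best'', ''p''} s5 s' \<and>
        reals s5 ''best'' 0 \<le> reals s' ''best'' 0 \<and>
        (\<forall>k<N. prefix_revenue v ?q5 ?o5 k ?e \<le> reals s' ''best'' 0) \<and>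
        (reals s' ''best'' 0 = reals s5 ''best'' 0 \<and> output_tariff s' = output_tariff s5 \<or>
         (\<exists>k<N. reals s' ''best'' 0 = prefix_revenue v ?q5 ?o5 k ?e \<and>
            output_tariff s' = (reals s5 ''h'' (?o5 k), ?e)))"
      then have fr': "same_except {''k'', ''Q''} {''best'', ''p''} s5 s'" by blast
      have eq: "reals s' ''e'' = reals s5 ''e''" "reals s' ''c'' = reals s5 ''c''" "nats s' ''q'' =
          ?q5"
        "nats s' ''ord'' = ?o5" "nats s' ''done'' = nats s5 ''done''"
        using fr' by (simp_all add: same_except_def)
      let ?B' = "reals s' ''best'' 0"
      have B: "0 \<le> reals s ''best'' 0" "reals s ''best'' 0 \<le> ?B'" using inv s' old
          by (auto simp: invariant_def)
      have at: "total_revenue N K v (p\<^sub>1, ?e) \<le> ?B'" if "0 \<le> p\<^sub>1" for p\<^sub>1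
        using total_revenue_le_prefix_revenue[OF po5 that e_nonneg q5] s' B by fastforce
      \<comment> \<open>The new quantities and order bound the revenue at the event, the old ones
        carry the bound across the interval to its right.\<close>
      have "total_revenue N K v \<rho> \<le> ?B'" if "\<rho> \<in> tariffs" "?e \<le> snd \<rho>" for \<rho>
        using inv by (intro revenue_bound_step[OF sw mx _ B _ at that]) (use e_less
            in \<open>auto simp: invariant_def\<close>)
      moreover have "output_tariff s' \<in> tariffs \<and> ?B' \<le> total_revenue N K v (output_tariff s')"
      proof -
        consider "?B' = reals s ''best'' 0" "output_tariff s' = output_tariff s"
          | k where "k < N" "?B' = prefix_revenue v ?q5 ?o5 k ?e" "output_tariff s' =
              (reals s5 ''h'' (?o5 k), ?e)"
          using s' old by auto
        then show ?thesis
        proof cases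
          case 1 then show ?thesis using inv by (simp add: invariant_def)
        next
          case 2
          have "0 \<le> reals s5 ''h'' (?o5 k)"
            using h5o[OF 2(1)] sur[OF o5[OF 2(1)]] surplus_nonneg[of K "v (?o5 k)" ?e] by simp
          moreover have "?B' \<le> total_revenue N K v (output_tariff s')"
            using prefix_revenue_le[OF po5 2(1) e_nonneg, where K = K] q5 sur 2 h5o[OF 2(1)] by simp
          ultimately show ?thesis using 2(3) e_nonneg by (simp add: tariffs_def)
        qed
      qed
      moreover have "loaded s'" using loaded_same_except[OF ld5 fr'] by simp
      moreover have "0 < ?e \<longrightarrow> piece_end N K v ?e"
        using next_event_piece_end[OF sw mx] e_less by simp
      ultimately show "?P6 s'"
        using e_nonneg e_less sw5 c5 B old assms(3) unfolding invariant_def eq by simp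
    qed simp_all
  qed
  have r7: "runs (If (RLess (RCast (NConst 0)) (rvar ''e'')) Skip (NWrite ''done'' (NConst 0)
      (NConst 1))) s6 20
      (\<lambda>s'. \<exists>e'. 0 \<le> e' \<and> e' < e \<and> (0 < e' \<longrightarrow> piece_end N K v e') \<and>
        invariant e' s' \<and> nats s' ''done'' 0 = (if 0 < e' then 0 else 1))" if s6: "?P6 s6" for s6
  proof (rule runs_loop_free)
    let ?s' = "run (If (RLess (RCast (NConst 0)) (rvar ''e'')) Skip (NWrite ''done'' (NConst 0)
        (NConst 1))) s6"
    have "same_except {''done''} {} s6 ?s'" by simp
    moreover have "loaded s6" using s6 by (simp add: invariant_def)
    ultimately have "loaded ?s'" using loaded_same_except by fastforce
    then have "invariant (reals s6 ''e'' 0) ?s'" using s6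
        by (simp add: invariant_def output_tariff_def)
    then show "\<exists>e'. 0 \<le> e' \<and> e' < e \<and> (0 < e' \<longrightarrow> piece_end N K v e') \<and>
        invariant e' ?s' \<and> nats ?s' ''done'' 0 = (if 0 < e' then 0 else 1)"
      using s6 by (intro exI[of _ "reals s6 ''e'' 0"]) simp
  qed simp_all
  show ?thesis unfolding sweep_step_def
    \<comment> \<open>The phases add up to \<open>1500 * (N * K) + 20\<close>.\<close>
    by (rule runs_Seq[OF r1], rule runs_Seq[OF r2], assumption, rule runs_Seq[OF r3], assumption,
        rule runs_Seq[OF r4], assumption, rule runs_Seq[OF r5], assumption, rule runs_Seq[OF r6],
        assumption, rule r7, assumption, (rule order_refl)+) (use size_bounds(1) in linarith)
qed

text \<open>Every step that reaches a positive event uses up a piece end below the current price.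
  \<open>Suc n\<close> leaves room for the step to 0, and the leading 5 pays for the failing
  test.\<close>

lemma runs_sweep_loop:
  assumes "invariant e s" "0 < e" "nats s ''done'' 0 = 0" "card {x. piece_end N K v x \<and> x < e} \<le> n"
  shows "runs (While (NLess (nvar ''done'') (NConst 1)) sweep_step) s (5 + Suc n * (5 + 2000 * (N *
      K))) (invariant 0)"
  using assms
proof (induction n arbitrary: e s rule: less_induct)
  case (less n)
  let ?c = "While (NLess (nvar ''done'') (NConst 1)) sweep_step"
  show ?case
  proof (rule runs_WhileTrue[OF _ runs_sweep_step[OF less.prems(1-3)]])
    show "bval (NLess (nvar ''done'') (NConst 1)) s" using less.prems by simp
    show "bcost (NLess (nvar ''done'') (NConst 1)) + 1 + 2000 * (N * K) + (5 + n * (5 + 2000 * (N *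
        K))) \<le>
        5 + Suc n * (5 + 2000 * (N * K))" by simp
    fix s' assume "\<exists>e'. 0 \<le> e' \<and> e' < e \<and> (0 < e' \<longrightarrow> piece_end N K v e') \<and>
      invariant e' s' \<and> nats s' ''done'' 0 = (if 0 < e' then 0 else 1)"
    then obtain e' where e': "0 \<le> e'" "e' < e" "0 < e' \<longrightarrow> piece_end N K v e'" "invariant e' s'"
      "nats s' ''done'' 0 = (if 0 < e' then 0 else 1)" by blast
    show "runs ?c s' (5 + n * (5 + 2000 * (N * K))) (invariant 0)"
    proof (cases "0 < e'")
      case True
      have "{x. piece_end N K v x \<and> x < e'} \<subseteq> {x. piece_end N K v x \<and> x < e}"
        "e' \<in> {x. piece_end N K v x \<and> x < e}" "e' \<notin> {x. piece_end N K v x \<and> x < e'}"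
        using e' True by auto
      then have "{x. piece_end N K v x \<and> x < e'} \<subset> {x. piece_end N K v x \<and> x < e}" by blast
      moreover have "finite {x. piece_end N K v x \<and> x < e}"
        using finite_piece_ends[of N K v] by (rule rev_finite_subset) auto
      ultimately have "card {x. piece_end N K v x \<and> x < e'} < card {x. piece_end N K v x \<and> x < e}"
        by (intro psubset_card_mono)
      then obtain m where m: "n = Suc m" "card {x. piece_end N K v x \<and> x < e'} \<le> m"
        using less.prems(4) by (cases n) auto
      then show ?thesis using less.IH[of m e' s'] e' True by simp
    next
      case False
      then have "e' = 0" using e' by simp
      then show ?thesis
        using e' by (intro runs_mono[OF runs_WhileFalse[where Q = "invariant 0"]]) simp_all
    qed
  qed
qed

section \<open>Start of the sweep and total running time\<close>

lemma runs_initialise: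
  "runs initialise (input_state N K v) (100 * (N * K))
     (\<lambda>s'. same_except {''i'', ''a'', ''o'', ''ord''} {} (input_state N K v) s' \<and>
        (\<forall>i<N. nats s' ''ord'' i = i \<and> nats s' ''o'' i = i * K))"
  (is "runs _ ?s _ ?Q")
proof -
  let ?S = "same_except {''i'', ''a'', ''o'', ''ord''} {} ?s"
  let ?I = "\<lambda>k s'. ?S s' \<and> nats s' ''a'' 0 = k * K \<and> (\<forall>i<k. nats s' ''ord'' i = i \<and>
      nats s' ''o'' i = i * K)"
  have NK: "nats ?s ''N'' 0 = N" "nats ?s ''K'' 0 = K" "nats ?s ''a'' 0 = 0"
      by (simp_all add: input_state_def)
  have "runs initialise ?s (100 * (N * K)) (?I N)" unfolding initialise_def
  proof (rule runs_For[where n = N and T = 50 and I = ?I, OF _ _ _ single_loop_time])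
    fix k s' assume s': "?I k s'" "nats s' ''i'' 0 = k"
    have "nats s' ''K'' 0 = K" using s' NK by (simp add: same_except_def)
    then show "runs (Seq (NWrite ''ord'' (nvar ''i'') (nvar ''i''))
        (Seq (NWrite ''o'' (nvar ''i'') (nvar ''a''))
          (NWrite ''a'' (NConst 0) (NAdd (nvar ''a'') (nvar ''K''))))) s' 50
        (\<lambda>s'. nats s' ''i'' 0 = k \<and> ?I (Suc k) (write_nat ''i'' 0 (Suc k) s'))"
      using s' by (intro runs_loop_free) (auto simp: less_Suc_eq)
  qed (use NK in \<open>auto simp: same_except_def\<close>)
  then show ?thesis by (rule runs_mono) auto
qed

lemma demand_eventually_zero: "\<exists>e>0. \<forall>p\<ge>e. \<forall>i<N. demand (v i) p K = 0"
proof -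
  \<comment> \<open>Strictly larger than every value, so even a single unit costs more than any
    quantity is worth.\<close>
  define e where "e = 1 + (\<Sum>i<N. \<Sum>r\<le>K. \<bar>v i r\<bar>)"
  have "0 < e" unfolding e_def by (simp add: add_pos_nonneg sum_nonneg)
  moreover have "demand (v i) p K = 0" if p: "e \<le> p" and i: "i < N" for p i
  proof -
    have neg: "line (v i) r p < 0" if r: "r \<le> K" "0 < r" for r
    proof -
      have "\<bar>v i r\<bar> \<le> (\<Sum>r\<le>K. \<bar>v i r\<bar>)" using r by (intro member_le_sum) auto
      also have "\<dots> \<le> (\<Sum>i<N. \<Sum>r\<le>K. \<bar>v i r\<bar>)"
        using i by (intro member_le_sum[where f = "\<lambda>i. \<Sum>r\<le>K. \<bar>v i r\<bar>"]) (auto intro: sum_nonneg)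
      finally have "v i r < p" using p unfolding e_def by linarith
      moreover have "p \<le> real r * p" using r p \<open>0 < e\<close> by simp
      ultimately show ?thesis using r by (simp add: line_def ext_def)
    qed
    have zero: "line (v i) 0 p = 0" by (simp add: line_def ext_def)
    show ?thesis
    proof (rule demand_eqI)
      show "line (v i) r p \<le> line (v i) 0 p" if "r \<le> K" for r
        using neg[OF that] zero by (cases "r = 0") auto
      show "line (v i) r p < line (v i) 0 p" if "r \<le> K" "0 < r" for r
        using neg[OF that] zero by simp
    qed simp
  qed
  ultimately show ?thesis by blast
qed

lemma invariant_initial:
  assumes fr: "same_except {''i'', ''a'', ''o'', ''ord''} {} (input_state N K v) s"
    and o: "\<forall>i<N. nats s ''ord'' i = i \<and> nats s ''o'' i = i * K"
    and e: "0 < e" "\<forall>p\<ge>e. \<forall>i<N. demand (v i) p K = 0"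
  shows "invariant e s"
proof -
  have nat: "nats s ''N'' 0 = N" "nats s ''K'' 0 = K" "nats s ''q'' = (\<lambda>_. 0)"
    and real: "reals s = reals (input_state N K v)"
    using fr by (auto simp: same_except_def input_state_def)
  have "i * K + r < N * K" if "i < N" "r < K" for i r
  proof -
    have "i * K + r < Suc i * K" using that by simp
    also have "\<dots> \<le> N * K" using that by (intro mult_le_mono1) simp
    finally show ?thesis .
  qed
  then have "loaded s" using nat o unfolding loaded_def real by (simp add: input_state_def)
  moreover have "bij_betw (nats s ''ord'') {..<N} {..<N}"
    using bij_betw_cong[of "{..<N}" id "nats s ''ord''" "{..<N}"] bij_betw_id[of "{..<N}"] o
    by (simp add: id_def)
  then have "swept N K v e (nats s ''q'') (nats s ''ord'')"
    using e by (simp add: swept_def height_order_def nat line_def ext_def)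
  moreover have "output_tariff s = (0, 0)" "reals s ''best'' 0 = 0" "\<And>i. reals s ''c'' i = 0"
    by (simp_all add: real input_state_def output_tariff_def)
  moreover have "revenue K (v i) (0, 0) = 0" for i by (simp add: revenue_eq_demand)
  then have "total_revenue N K v (0, 0) = 0" by (simp add: total_revenue_def)
  moreover have "total_revenue N K v \<rho> = 0" if "\<rho> \<in> tariffs" "e \<le> snd \<rho>" for \<rho>
  proof -
    obtain p1 p where \<rho>: "\<rho> = (p1, p)" by (cases \<rho>)
    then show ?thesis using that e(2) by (simp add: total_revenue_def revenue_eq_demand tariffs_def)
  qed
  ultimately show ?thesis by (simp add: invariant_def tariffs_def nat ext_def)
qed

lemma card_pieces_pos: "1 \<le> card (pieces N K v)"
proof -
  have "(0, 0) \<in> tariffs" by (simp add: tariffs_def)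
  then have "same_purchases N K v `` {(0, 0)} \<in> pieces N K v" by (auto simp: pieces_def quotientI)
  then have "pieces N K v \<noteq> {}" by blast
  then show ?thesis using finite_pieces[of N K v] by (simp add: Suc_le_eq card_gt_0_iff)
qed

lemma runs_sweep: "runs sweep (input_state N K v) (5000 * (card (pieces N K v) * N * K)) (invariant
    0)"
  unfolding sweep_def
proof (rule runs_Seq[OF runs_initialise])
  let ?R = "card (pieces N K v)"
  obtain e where e: "0 < e" "\<forall>p\<ge>e. \<forall>i<N. demand (v i) p K = 0" using demand_eventually_zero by blast
  fix s assume s: "same_except {''i'', ''a'', ''o'', ''ord''} {} (input_state N K v) s \<and>
        (\<forall>i<N. nats s ''ord'' i = i \<and> nats s ''o'' i = i * K)"
  have "card {x. piece_end N K v x \<and> x < e} \<le> card {x. piece_end N K v x}"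
    using finite_piece_ends by (intro card_mono) auto
  also have "\<dots> \<le> ?R" by (rule card_piece_ends)
  finally have "card {x. piece_end N K v x \<and> x < e} \<le> ?R" .
  moreover have "nats s ''done'' 0 = 0" using s by (simp add: same_except_def input_state_def)
  ultimately show "runs (While (NLess (nvar ''done'') (NConst 1)) sweep_step) s
      (5 + Suc ?R * (5 + 2000 * (N * K))) (invariant 0)"
    using invariant_initial[of s e] s e by (intro runs_sweep_loop) auto
next
  let ?R = "card (pieces N K v)" and ?M = "N * K"
  have M: "1 \<le> ?M" using size_bounds(1) .
  have R: "1 \<le> ?R" using card_pieces_pos .
  have "?M \<le> ?R * ?M" using mult_le_mono1[OF R, of ?M] by simp
  \<comment> \<open>At least one piece gives \<open>Suc ?R \<le> 2 * ?R\<close>, and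
    \<open>?M \<ge> 1\<close> absorbs the additive 5; with the initialisation the total factor is
    4115.\<close>
  moreover have "Suc ?R * (5 + 2000 * ?M) \<le> (2 * ?R) * (2005 * ?M)"
    using M R by (intro mult_le_mono) linarith+
  moreover have "(2 * ?R) * (2005 * ?M) = 4010 * (?R * ?M)" by simp
  ultimately have "100 * ?M + (5 + Suc ?R * (5 + 2000 * ?M)) \<le> 5000 * (?R * ?M)" using M by linarith
  then show "100 * ?M + (5 + Suc ?R * (5 + 2000 * ?M)) \<le> 5000 * (?R * N * K)"
      by (simp add: mult.assoc)
qed

lemma invariant_zero_optimal:
  assumes "invariant 0 s"
  shows "is_arg_max (total_revenue N K v) (\<lambda>\<rho>. \<rho> \<in> tariffs) (output_tariff s)"
proof -
  have "total_revenue N K v \<rho> \<le> total_revenue N K v (output_tariff s)" if "\<rho> \<in> tariffs" for \<rho>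
    using assms that by (force simp: invariant_def tariffs_def)
  moreover have "output_tariff s \<in> tariffs" using assms by (simp add: invariant_def)
  ultimately show ?thesis by (auto simp: is_arg_max_def not_less)
qed

end

theorem theorem6:
  shows "\<exists>(prog :: com) (C :: nat). \<forall>(N :: nat) (K :: nat) (v :: nat \<Rightarrow> nat \<Rightarrow> real).
    1 \<le> N \<longrightarrow> 1 \<le> K \<longrightarrow> (\<forall>i<N. \<forall>q\<in>{1..K}. 0 \<le> v i q) \<longrightarrow>
    (\<exists>t s. exec prog (input_state N K v) t s \<and>
       is_arg_max (total_revenue N K v) (\<lambda>\<rho>. \<rho> \<in> tariffs) (output_tariff s) \<and>
       t \<le> C * (card (pieces N K v) * N * K))"
proof (rule exI[of _ sweep], rule exI[of _ 5000], intro allI impI)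
  fix N K :: nat and v :: "nat \<Rightarrow> nat \<Rightarrow> real"
  assume "1 \<le> N" "1 \<le> K"
  then interpret tariff_instance N K v by unfold_locales
  obtain t s where "exec sweep (input_state N K v) t s" "t \<le>
      5000 * (card (pieces N K v) * N * K)" "invariant 0 s"
    using runs_sweep by (auto simp: runs_def)
  then show "\<exists>t s. exec sweep (input_state N K v) t s \<and>
       is_arg_max (total_revenue N K v) (\<lambda>\<rho>. \<rho> \<in> tariffs) (output_tariff s) \<and>
       t \<le> 5000 * (card (pieces N K v) * N * K)"
    using invariant_zero_optimal by blast
qed

end
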